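(* Let $\mathbf{k}$ be a field with $\operatorname{char}(\mathbf{k})\neq 2,3$, and let $X$ and $Y$ be finite quandles which are (right) orbit $2$-transitive; in case $\operatorname{char}(\mathbf{k})=p>3$, assume moreover that none of the groups $G_{X_i}$ and $G_{Y_j}$ associated with the orbits of $X$ and $Y$ is among the exceptional groups (i)–(v) listed in the context. If the quandle rings $\mathbf{k}[X]$ and $\mathbf{k}[Y]$ are isomorphic, then $X$ and $Y$ are of the same partition type.
   Context: A quandle is a set $X$ with a binary operation $\triangleright$ such that: (I) $a\triangleright a=a$; (II) for all $a,b\in X$ there is a unique $c\in X$ with $a=c\triangleright b$; (III) $(a\triangleright b)\triangleright c=(a\triangleright c)\triangleright(b\triangleright c)$ for all $a,b,c$. The quandle ring $\mathbf{k}[X]$ is the $\mathbf{k}$-vector space with basis $X$ and the (generally nonassociative) multiplication $\left(\sum_{x}a_x x\right)\cdot\left(\sum_{y}b_y y\right)=\sum_{x,y}a_xb_y\,(x\triangleright y)$. For $x\in X$ let $R_x:y\mapsto y\triangleright x$ (a bijection of $X$); $\operatorname{Inn}(X)$ is the group generated by all $R_x$, and the orbits $X_1,\dots,X_k$ of $X$ are the orbits of $\operatorname{Inn}(X)$. $G_{X_i}$ is the group of permutations of $X_i$ generated by the restrictions $R_x|_{X_i}$, $x\in X$. A group $G$ acts $2$-transitively on a set $Z$ if for any $(x_1,y_1),(x_2,y_2)\in Z\times Z$ with $x_1\neq y_1$, $x_2\neq y_2$ there is $g\in G$ with $g\cdot x_1=x_2$, $g\cdot y_1=y_2$. The finite quandle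 $X$ is (right) orbit $2$-transitive if each $G_{X_i}$ acts $2$-transitively on $X_i$. The partition type of a finite quandle $X$ of cardinality $n$ is $\lambda=(\lambda_1,\dots,\lambda_n)$, where $\lambda_j$ is the number of orbits of cardinality $j$ in $X$. Exceptional groups (permutation groups $G$, in their natural $2$-transitive actions; $p=\operatorname{char}(\mathbf{k})$): (i) $G\leqslant A\Gamma L(m,q)$ and $p$ divides $q$; (ii) $G\leqslant P\Gamma L(m,q)$, $m\geq 3$, and $p$ divides $q$; (iii) $G\leqslant P\Gamma U(3,q)$ and $p$ divides $q+1$; (iv) $G\leqslant Sz(q)$ and $p$ divides $q+1+m$, where $m^2=2q$; (v) $G\leqslant Re(q)$ and $p$ divides $(q+1)(q+1+m)$, where $m^2=3q$. Here $A\Gamma L$, $P\Gamma L$, $P\Gamma U$, $Sz$, $Re$ are the affine general semilinear, projective general semilinear, projective semilinear unitary, Suzuki and Ree groups. *)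

theory Defs
  imports
    "HOL-Algebra.Bij"
    "HOL-Algebra.Generated_Groups"
    "HOL-Algebra.Group_Action"
    "HOL-Algebra.Module"
    "HOL-Algebra.QuotRing"
    "HOL-Library.Poly_Mapping"
begin

section \<open>Quandles\<close>

locale quandle =
  fixes X :: "'a set" and qop :: "'a \<Rightarrow> 'a \<Rightarrow> 'a" (infixl \<open>\<triangleright>\<close> 70)
  assumes closed: "\<lbrakk>a \<in> X; b \<in> X\<rbrakk> \<Longrightarrow> a \<triangleright> b \<in> X"
    and idem: "a \<in> X \<Longrightarrow> a \<triangleright> a = a"
    and right_div: "\<lbrakk>a \<in> X; b \<in> X\<rbrakk> \<Longrightarrow> \<exists>!c. c \<in> X \<and> a = c \<triangleright> b"
    and right_distrib:
      "\<lbrakk>a \<in> X; b \<in> X; c \<in> X\<rbrakk> \<Longrightarrow> (a \<triangleright> b) \<triangleright> c = (a \<triangleright> c) \<triangleright> (b \<triangleright> c)"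

text \<open>Permutations of a set \<open>Z\<close> are elements of \<open>Bij Z\<close>, so they are undefined outside \<open>Z\<close>.\<close>

definition right_mult :: "('a \<Rightarrow> 'a \<Rightarrow> 'a) \<Rightarrow> 'a set \<Rightarrow> 'a \<Rightarrow> ('a \<Rightarrow> 'a)" where
  "right_mult qop Z x = (\<lambda>y\<in>Z. qop y x)"

definition Inn :: "'a set \<Rightarrow> ('a \<Rightarrow> 'a \<Rightarrow> 'a) \<Rightarrow> ('a \<Rightarrow> 'a) set" where
  "Inn X qop = generate (BijGroup X) (right_mult qop X ` X)"

definition quandle_orbits :: "'a set \<Rightarrow> ('a \<Rightarrow> 'a \<Rightarrow> 'a) \<Rightarrow> 'a set set" where
  "quandle_orbits X qop = orbits ((BijGroup X)\<lparr>carrier := Inn X qop\<rparr>) X (\<lambda>g. g)"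

definition orbit_group :: "'a set \<Rightarrow> ('a \<Rightarrow> 'a \<Rightarrow> 'a) \<Rightarrow> 'a set \<Rightarrow> ('a \<Rightarrow> 'a) set" where
  "orbit_group X qop Z = generate (BijGroup Z) (right_mult qop Z ` X)"

definition two_transitive :: "('a \<Rightarrow> 'a) set \<Rightarrow> 'a set \<Rightarrow> bool" where
  "two_transitive G Z \<longleftrightarrow>
     (\<forall>x1\<in>Z. \<forall>y1\<in>Z. \<forall>x2\<in>Z. \<forall>y2\<in>Z. x1 \<noteq> y1 \<and> x2 \<noteq> y2 \<longrightarrow>
        (\<exists>g\<in>G. g x1 = x2 \<and> g y1 = y2))"

definition orbit_two_transitive :: "'a set \<Rightarrow> ('a \<Rightarrow> 'a \<Rightarrow> 'a) \<Rightarrow> bool" where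
  "orbit_two_transitive X qop \<longleftrightarrow>
     (\<forall>Z\<in>quandle_orbits X qop. two_transitive (orbit_group X qop Z) Z)"

definition partition_type :: "'a set \<Rightarrow> ('a \<Rightarrow> 'a \<Rightarrow> 'a) \<Rightarrow> nat list" where
  "partition_type X qop =
     map (\<lambda>j. card {Z \<in> quandle_orbits X qop. card Z = j}) [1..<card X + 1]"


section \<open>Quandle rings\<close>

text \<open>The quandle ring has no unit in general, so isomorphisms are not required to respect
  a unit and \<^const>\<open>ring_iso\<close> does not apply. They are additive, but not required to be
  linear over the field.\<close>

definition quandle_ring :: "'a set \<Rightarrow> ('a \<Rightarrow>\<^sub>0 'k::field) set" where
  "quandle_ring X = {f. Poly_Mapping.keys f \<subseteq> X}"

definition quandle_ring_mult ::
    "('a \<Rightarrow> 'a \<Rightarrow> 'a) \<Rightarrow> ('a \<Rightarrow>\<^sub>0 'k::field) \<Rightarrow> ('a \<Rightarrow>\<^sub>0 'k) \<Rightarrow> ('a \<Rightarrow>\<^sub>0 'k)" where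
  "quandle_ring_mult qop f g =
     (\<Sum>x\<in>Poly_Mapping.keys f. \<Sum>y\<in>Poly_Mapping.keys g.
        Poly_Mapping.single (qop x y) (Poly_Mapping.lookup f x * Poly_Mapping.lookup g y))"

definition quandle_ring_iso ::
    "'a set \<Rightarrow> ('a \<Rightarrow> 'a \<Rightarrow> 'a) \<Rightarrow> 'b set \<Rightarrow> ('b \<Rightarrow> 'b \<Rightarrow> 'b) \<Rightarrow>
      (('a \<Rightarrow>\<^sub>0 'k::field) \<Rightarrow> ('b \<Rightarrow>\<^sub>0 'k)) set" where
  "quandle_ring_iso X qop Y qop' =
     {\<phi>. bij_betw \<phi> (quandle_ring X) (quandle_ring Y) \<and>
         (\<forall>f\<in>quandle_ring X. \<forall>g\<in>quandle_ring X.
            \<phi> (f + g) = \<phi> f + \<phi> g \<and>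
            \<phi> (quandle_ring_mult qop f g) = quandle_ring_mult qop' (\<phi> f) (\<phi> g))}"


section \<open>Classical permutation groups\<close>

text \<open>Finite fields are rings on subsets of \<^typ>\<open>nat\<close>; every finite field has
  such a copy.\<close>

definition coord_space :: "nat ring \<Rightarrow> nat \<Rightarrow> (nat, nat \<Rightarrow> nat) module" where
  "coord_space F m =
     \<lparr>carrier = {..<m} \<rightarrow>\<^sub>E carrier F,
      monoid.mult = undefined, one = undefined,
      zero = (\<lambda>i\<in>{..<m}. \<zero>\<^bsub>F\<^esub>),
      add = (\<lambda>u v. \<lambda>i\<in>{..<m}. u i \<oplus>\<^bsub>F\<^esub> v i),
      smult = (\<lambda>a v. \<lambda>i\<in>{..<m}. a \<otimes>\<^bsub>F\<^esub> v i)\<rparr>"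

definition semilinear_bij ::
    "nat ring \<Rightarrow> nat \<Rightarrow> (nat \<Rightarrow> nat) \<Rightarrow> ((nat \<Rightarrow> nat) \<Rightarrow> (nat \<Rightarrow> nat)) set" where
  "semilinear_bij F m \<sigma> =
     (let V = coord_space F m in
      {T \<in> Bij (carrier V).
         (\<forall>u\<in>carrier V. \<forall>v\<in>carrier V. T (u \<oplus>\<^bsub>V\<^esub> v) = T u \<oplus>\<^bsub>V\<^esub> T v) \<and>
         (\<forall>a\<in>carrier F. \<forall>v\<in>carrier V. T (a \<odot>\<^bsub>V\<^esub> v) = \<sigma> a \<odot>\<^bsub>V\<^esub> T v)})"

definition GammaL :: "nat ring \<Rightarrow> nat \<Rightarrow> ((nat \<Rightarrow> nat) \<Rightarrow> (nat \<Rightarrow> nat)) set" where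
  "GammaL F m = (\<Union>\<sigma>\<in>ring_iso F F. semilinear_bij F m \<sigma>)"

definition AGammaL :: "nat ring \<Rightarrow> nat \<Rightarrow> ((nat \<Rightarrow> nat) \<Rightarrow> (nat \<Rightarrow> nat)) set" where
  "AGammaL F m =
     (let V = coord_space F m in
      {(\<lambda>v\<in>carrier V. T v \<oplus>\<^bsub>V\<^esub> b) | T b. T \<in> GammaL F m \<and> b \<in> carrier V})"

definition line_through :: "nat ring \<Rightarrow> nat \<Rightarrow> (nat \<Rightarrow> nat) \<Rightarrow> (nat \<Rightarrow> nat) set" where
  "line_through F m v = (\<lambda>a. a \<odot>\<^bsub>coord_space F m\<^esub> v) ` carrier F"

definition proj_points :: "nat ring \<Rightarrow> nat \<Rightarrow> (nat \<Rightarrow> nat) set set" where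
  "proj_points F m =
     line_through F m ` (carrier (coord_space F m) - {\<zero>\<^bsub>coord_space F m\<^esub>})"

definition PGammaL :: "nat ring \<Rightarrow> nat \<Rightarrow> ((nat \<Rightarrow> nat) set \<Rightarrow> (nat \<Rightarrow> nat) set) set" where
  "PGammaL F m = {(\<lambda>L\<in>proj_points F m. T ` L) | T. T \<in> GammaL F m}"

text \<open>For the unitary group, \<open>F\<close> has \<open>q\<^sup>2\<close> elements, \<open>a \<mapsto> a\<^sup>q\<close> is its involution, and all
  nondegenerate Hermitian forms on \<open>F\<^sup>3\<close> are equivalent. Allowing \<open>h (T u) (T v)\<close> to differ
  from \<open>\<sigma> (h u v)\<close> by a scalar would yield the same permutations of the
  isotropic points, since the norm map to the field with \<open>q\<close> elements is onto.\<close>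

definition hermitian :: "nat ring \<Rightarrow> nat \<Rightarrow> (nat \<Rightarrow> nat) \<Rightarrow> (nat \<Rightarrow> nat) \<Rightarrow> nat" where
  "hermitian F q u v = (\<Oplus>\<^bsub>F\<^esub>i\<in>{..<3}. u i \<otimes>\<^bsub>F\<^esub> (v i [^]\<^bsub>F\<^esub> q))"

definition isotropic_points :: "nat ring \<Rightarrow> nat \<Rightarrow> (nat \<Rightarrow> nat) set set" where
  "isotropic_points F q =
     {line_through F 3 v | v.
        v \<in> carrier (coord_space F 3) \<and> v \<noteq> \<zero>\<^bsub>coord_space F 3\<^esub> \<and> hermitian F q v v = \<zero>\<^bsub>F\<^esub>}"

definition PGammaU3 :: "nat ring \<Rightarrow> nat \<Rightarrow> ((nat \<Rightarrow> nat) set \<Rightarrow> (nat \<Rightarrow> nat) set) set" where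
  "PGammaU3 F q =
     {(\<lambda>L\<in>isotropic_points F q. T ` L) | T \<sigma>.
        \<sigma> \<in> ring_iso F F \<and> T \<in> semilinear_bij F 3 \<sigma> \<and>
        (\<forall>u\<in>carrier (coord_space F 3). \<forall>v\<in>carrier (coord_space F 3).
           hermitian F q (T u) (T v) = \<sigma> (hermitian F q u v))}"

text \<open>The Suzuki and Ree groups are given by the standard generators of their actions
  on the Suzuki--Tits and Ree--Tits ovoids (Dixon and Mortimer, Permutation Groups, Section 7.7).
  With \<open>m\<^sup>2 = r * q\<close> (\<open>r = 2\<close> or \<open>r = 3\<close>), the map \<open>\<sigma> x = x\<^sup>m\<close> is the automorphism whose
  square is \<open>x \<mapsto> x\<^sup>r\<close>. The ovoid consists of a point at infinity, \<^const>\<open>None\<close>, and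
  affine points with coordinates \<open>(x, y, c)\<close> in the Suzuki case and \<open>(x, y, z, c4, c5, c6)\<close> in
  the Ree case; the remaining coordinates are functions of the listed variables \<open>x, y\<close> and
  \<open>x, y, z\<close>, so points are encoded by these.

  The generators are translations, which are regular on the affine points, dilations, and an
  involution exchanging the origin and infinity. The smallest cases \<open>Sz(2)\<close> and
  \<open>Re(3)\<close> are included.\<close>

definition Sz_points :: "nat ring \<Rightarrow> (nat \<times> nat) option set" where
  "Sz_points F = insert None (Some ` (carrier F \<times> carrier F))"

definition Sz_coord :: "nat ring \<Rightarrow> nat \<Rightarrow> nat \<Rightarrow> nat \<Rightarrow> nat" where
  "Sz_coord F m x y =
     (let \<sigma> = (\<lambda>a. a [^]\<^bsub>F\<^esub> m) in
      x \<otimes>\<^bsub>F\<^esub> y \<oplus>\<^bsub>F\<^esub> \<sigma> x \<otimes>\<^bsub>F\<^esub> x [^]\<^bsub>F\<^esub> (2::nat) \<oplus>\<^bsub>F\<^esub> \<sigma> y)"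

definition Sz_trans ::
    "nat ring \<Rightarrow> nat \<Rightarrow> nat \<Rightarrow> nat \<Rightarrow> ((nat \<times> nat) option \<Rightarrow> (nat \<times> nat) option)" where
  "Sz_trans F m a b =
     (\<lambda>P\<in>Sz_points F. map_option
        (\<lambda>(x, y). (x \<oplus>\<^bsub>F\<^esub> a, y \<oplus>\<^bsub>F\<^esub> b \<oplus>\<^bsub>F\<^esub> a [^]\<^bsub>F\<^esub> m \<otimes>\<^bsub>F\<^esub> x)) P)"

definition Sz_dil ::
    "nat ring \<Rightarrow> nat \<Rightarrow> nat \<Rightarrow> ((nat \<times> nat) option \<Rightarrow> (nat \<times> nat) option)" where
  "Sz_dil F m k =
     (\<lambda>P\<in>Sz_points F. map_option
        (\<lambda>(x, y). (k \<otimes>\<^bsub>F\<^esub> x, k [^]\<^bsub>F\<^esub> (m + 1) \<otimes>\<^bsub>F\<^esub> y)) P)"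

definition Sz_inv ::
    "nat ring \<Rightarrow> nat \<Rightarrow> ((nat \<times> nat) option \<Rightarrow> (nat \<times> nat) option)" where
  "Sz_inv F m =
     (\<lambda>P\<in>Sz_points F. case P of
        None \<Rightarrow> Some (\<zero>\<^bsub>F\<^esub>, \<zero>\<^bsub>F\<^esub>)
      | Some (x, y) \<Rightarrow>
          (if x = \<zero>\<^bsub>F\<^esub> \<and> y = \<zero>\<^bsub>F\<^esub> then None
           else let d = inv\<^bsub>F\<^esub> (Sz_coord F m x y) in Some (y \<otimes>\<^bsub>F\<^esub> d, x \<otimes>\<^bsub>F\<^esub> d)))"

definition Sz :: "nat ring \<Rightarrow> nat \<Rightarrow> ((nat \<times> nat) option \<Rightarrow> (nat \<times> nat) option) set" where
  "Sz F m = generate (BijGroup (Sz_points F))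
     ({Sz_trans F m a b | a b. a \<in> carrier F \<and> b \<in> carrier F} \<union>
      {Sz_dil F m k | k. k \<in> carrier F - {\<zero>\<^bsub>F\<^esub>}} \<union> {Sz_inv F m})"

definition Ree_points :: "nat ring \<Rightarrow> (nat \<times> nat \<times> nat) option set" where
  "Ree_points F = insert None (Some ` (carrier F \<times> carrier F \<times> carrier F))"

definition Ree_coord4 :: "nat ring \<Rightarrow> nat \<Rightarrow> nat \<Rightarrow> nat \<Rightarrow> nat \<Rightarrow> nat" where
  "Ree_coord4 F m x y z =
     (x [^]\<^bsub>F\<^esub> (2::nat) \<otimes>\<^bsub>F\<^esub> y \<ominus>\<^bsub>F\<^esub> x \<otimes>\<^bsub>F\<^esub> z \<oplus>\<^bsub>F\<^esub> y [^]\<^bsub>F\<^esub> m \<ominus>\<^bsub>F\<^esub> x [^]\<^bsub>F\<^esub> (m + 3))"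

definition Ree_coord5 :: "nat ring \<Rightarrow> nat \<Rightarrow> nat \<Rightarrow> nat \<Rightarrow> nat \<Rightarrow> nat" where
  "Ree_coord5 F m x y z =
     (x [^]\<^bsub>F\<^esub> m \<otimes>\<^bsub>F\<^esub> y [^]\<^bsub>F\<^esub> m \<ominus>\<^bsub>F\<^esub> z [^]\<^bsub>F\<^esub> m \<oplus>\<^bsub>F\<^esub> x \<otimes>\<^bsub>F\<^esub> y [^]\<^bsub>F\<^esub> (2::nat)
      \<oplus>\<^bsub>F\<^esub> y \<otimes>\<^bsub>F\<^esub> z \<ominus>\<^bsub>F\<^esub> x [^]\<^bsub>F\<^esub> (2 * m + 3))"

definition Ree_coord6 :: "nat ring \<Rightarrow> nat \<Rightarrow> nat \<Rightarrow> nat \<Rightarrow> nat \<Rightarrow> nat" where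
  "Ree_coord6 F m x y z =
     (x \<otimes>\<^bsub>F\<^esub> z [^]\<^bsub>F\<^esub> m \<ominus>\<^bsub>F\<^esub> x [^]\<^bsub>F\<^esub> (m + 1) \<otimes>\<^bsub>F\<^esub> y [^]\<^bsub>F\<^esub> m
      \<oplus>\<^bsub>F\<^esub> x [^]\<^bsub>F\<^esub> (m + 3) \<otimes>\<^bsub>F\<^esub> y \<oplus>\<^bsub>F\<^esub> x [^]\<^bsub>F\<^esub> (2::nat) \<otimes>\<^bsub>F\<^esub> y [^]\<^bsub>F\<^esub> (2::nat)
      \<ominus>\<^bsub>F\<^esub> y [^]\<^bsub>F\<^esub> (m + 1) \<ominus>\<^bsub>F\<^esub> z [^]\<^bsub>F\<^esub> (2::nat) \<oplus>\<^bsub>F\<^esub> x [^]\<^bsub>F\<^esub> (2 * m + 4))"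

definition Ree_trans ::
    "nat ring \<Rightarrow> nat \<Rightarrow> nat \<Rightarrow> nat \<Rightarrow> nat \<Rightarrow>
      ((nat \<times> nat \<times> nat) option \<Rightarrow> (nat \<times> nat \<times> nat) option)" where
  "Ree_trans F m a b c =
     (\<lambda>P\<in>Ree_points F. map_option
        (\<lambda>(x, y, z).
           (x \<oplus>\<^bsub>F\<^esub> a,
            y \<oplus>\<^bsub>F\<^esub> b \<oplus>\<^bsub>F\<^esub> a [^]\<^bsub>F\<^esub> m \<otimes>\<^bsub>F\<^esub> x,
            z \<oplus>\<^bsub>F\<^esub> c \<ominus>\<^bsub>F\<^esub> a \<otimes>\<^bsub>F\<^esub> y \<oplus>\<^bsub>F\<^esub> b \<otimes>\<^bsub>F\<^esub> x \<ominus>\<^bsub>F\<^esub> a [^]\<^bsub>F\<^esub> (m + 1) \<otimes>\<^bsub>F\<^esub> x)) P)"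

definition Ree_dil ::
    "nat ring \<Rightarrow> nat \<Rightarrow> nat \<Rightarrow>
      ((nat \<times> nat \<times> nat) option \<Rightarrow> (nat \<times> nat \<times> nat) option)" where
  "Ree_dil F m k =
     (\<lambda>P\<in>Ree_points F. map_option
        (\<lambda>(x, y, z).
           (k \<otimes>\<^bsub>F\<^esub> x, k [^]\<^bsub>F\<^esub> (m + 1) \<otimes>\<^bsub>F\<^esub> y, k [^]\<^bsub>F\<^esub> (m + 2) \<otimes>\<^bsub>F\<^esub> z)) P)"

definition Ree_inv ::
    "nat ring \<Rightarrow> nat \<Rightarrow>
      ((nat \<times> nat \<times> nat) option \<Rightarrow> (nat \<times> nat \<times> nat) option)" where
  "Ree_inv F m =
     (\<lambda>P\<in>Ree_points F. case P of
        None \<Rightarrow> Some (\<zero>\<^bsub>F\<^esub>, \<zero>\<^bsub>F\<^esub>, \<zero>\<^bsub>F\<^esub>)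
      | Some (x, y, z) \<Rightarrow>
          (if x = \<zero>\<^bsub>F\<^esub> \<and> y = \<zero>\<^bsub>F\<^esub> \<and> z = \<zero>\<^bsub>F\<^esub> then None
           else let d = inv\<^bsub>F\<^esub> (Ree_coord6 F m x y z) in
             Some (Ree_coord5 F m x y z \<otimes>\<^bsub>F\<^esub> d, Ree_coord4 F m x y z \<otimes>\<^bsub>F\<^esub> d, z \<otimes>\<^bsub>F\<^esub> d)))"

definition Ree ::
    "nat ring \<Rightarrow> nat \<Rightarrow>
      ((nat \<times> nat \<times> nat) option \<Rightarrow> (nat \<times> nat \<times> nat) option) set" where
  "Ree F m = generate (BijGroup (Ree_points F))
     ({Ree_trans F m a b c | a b c. a \<in> carrier F \<and> b \<in> carrier F \<and> c \<in> carrier F} \<union>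
      {Ree_dil F m k | k. k \<in> carrier F - {\<zero>\<^bsub>F\<^esub>}} \<union> {Ree_inv F m})"


section \<open>Exceptional permutation groups\<close>

text \<open>The group \<open>G\<close> acting on \<open>Z\<close> is permutation isomorphic to a subgroup of the group \<open>H\<close>
  acting on \<open>W\<close>.\<close>

definition perm_subgroup ::
    "('a \<Rightarrow> 'a) set \<Rightarrow> 'a set \<Rightarrow> ('b \<Rightarrow> 'b) set \<Rightarrow> 'b set \<Rightarrow> bool" where
  "perm_subgroup G Z H W \<longleftrightarrow>
     (\<exists>\<beta>. bij_betw \<beta> Z W \<and> (\<forall>g\<in>G. \<exists>h\<in>H. \<forall>z\<in>Z. \<beta> (g z) = h (\<beta> z)))"

definition exceptional :: "nat \<Rightarrow> ('a \<Rightarrow> 'a) set \<Rightarrow> 'a set \<Rightarrow> bool" where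
  "exceptional p G Z \<longleftrightarrow>
     (\<exists>(F :: nat ring) q m. field F \<and> finite (carrier F) \<and>
        (card (carrier F) = q \<and> m \<ge> 1 \<and> p dvd q \<and>
           perm_subgroup G Z (AGammaL F m) (carrier (coord_space F m))
       \<or> card (carrier F) = q \<and> m \<ge> 3 \<and> p dvd q \<and>
           perm_subgroup G Z (PGammaL F m) (proj_points F m)
       \<or> card (carrier F) = q ^ 2 \<and> p dvd q + 1 \<and>
           perm_subgroup G Z (PGammaU3 F q) (isotropic_points F q)
       \<or> card (carrier F) = q \<and> m ^ 2 = 2 * q \<and> p dvd q + 1 + m \<and>
           perm_subgroup G Z (Sz F m) (Sz_points F)
       \<or> card (carrier F) = q \<and> m ^ 2 = 3 * q \<and> p dvd (q + 1) * (q + 1 + m) \<and>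
           perm_subgroup G Z (Ree F m) (Ree_points F)))"

end

theory Submission
  imports Defs "HOL.Vector_Spaces" "HOL-Library.Function_Algebras"
begin

text \<open>
  As a right module over itself, \<open>k[X]\<close> is the direct sum of the \<open>k[Z]\<close>, \<open>Z\<close> an orbit, and a module
  endomorphism is a linear map that commutes with all right translations. By 2-transitivity, the
  endomorphisms of \<open>k[Z]\<close> are the combinations of the identity and the all-ones matrix, so they act
  by scalars on the augmentation-zero part \<open>D(Z)\<close> of \<open>k[Z]\<close>. Hence a Krull--Schmidt argument applies
  modulo maps that vanish on the \<open>D(Z)\<close>: grouping the orbits of \<open>X\<close> and of \<open>Y\<close> by the isomorphism
  type of \<open>D(Z)\<close>, where a pair of inverse isomorphisms is required to come from module maps
  between the \<open>k[Z]\<close>, a class has as many members in \<open>X\<close> as in \<open>Y\<close>. The \<open>D(Z)\<close> may be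
  reducible; only the scalar action matters.

  A ring isomorphism \<open>\<phi>\<close> need not be linear, but it respects augmentations up to a field
  homomorphism, and on a pair of matching pieces it is semilinear after composition with a module
  map. This suffices to compare \<open>dim D(Z) = |Z| - 1\<close> on both sides. One-element orbits, for which
  \<open>D(Z) = 0\<close>, are covered by comparing the number of orbits via the augmentations.
\<close>

subsection \<open>Two counting principles\<close>

abbreviation "keys \<equiv> Poly_Mapping.keys"
abbreviation "lookup \<equiv> Poly_Mapping.lookup"
abbreviation "single \<equiv> Poly_Mapping.single"

text \<open>The relation \<open>A B = 1\<close> makes the rows of \<open>A\<close> linearly
  independent in a space spanned by \<open>card J\<close> unit vectors. The counts of orbits and the
  comparison of dimensions below all reduce to this.\<close>

lemma card_le_if_matrix_inverse:
  fixes A :: "'i \<Rightarrow> 'j \<Rightarrow> 'k::field"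
  assumes fin: "finite I" "finite J"
    and inv: "\<And>i l. i \<in> I \<Longrightarrow> l \<in> I \<Longrightarrow> (\<Sum>j\<in>J. A i j * B j l) = (if i = l then 1 else 0)"
  shows "card I \<le> card J"
proof -
  define sc where "sc = (\<lambda>(c::'k) (f::'j \<Rightarrow> 'k) j. c * f j)"
  interpret vector_space sc
    by unfold_locales (auto simp: sc_def fun_eq_iff algebra_simps)
  \<comment> \<open>Rows are extended by zero outside \<open>J\<close>, so that they lie in the span
    of the unit vectors \<open>e j\<close>; \<open>T\<close> is multiplication by \<open>B\<close>
    on the right.\<close>
  define r where "r = (\<lambda>i j. if j \<in> J then A i j else 0)"
  define e where "e = (\<lambda>(j::'j) l. if l = j then 1 else (0::'k))"
  define T where "T = (\<lambda>f l. \<Sum>j\<in>J. f j * B j l)"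
  have T_r: "T (r i) l = (if i = l then 1 else 0)" if "i \<in> I" "l \<in> I" for i l
    using inv[OF that] by (simp add: T_def r_def cong: sum.cong)
  have inj: "inj_on r I"
  proof (rule inj_onI)
    fix i l assume *: "i \<in> I" "l \<in> I" "r i = r l"
    then have "T (r i) l = T (r l) l" by simp
    then show "i = l" using T_r[OF *(1,2)] T_r[OF *(2,2)] by (simp split: if_splits)
  qed
  have "independent (r ` I)"
  proof (rule independent_if_scalars_zero)
    fix c x assume eq: "(\<Sum>x\<in>r ` I. sc (c x) x) = 0" and "x \<in> r ` I"
    then obtain l where l: "l \<in> I" "x = r l" by auto
    have sum0: "(\<Sum>i\<in>I. sc (c (r i)) (r i)) = 0"
      using eq by (simp add: sum.reindex[OF inj])
    have pt: "(\<Sum>i\<in>I. c (r i) * r i j) = 0" for j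
    proof -
      have "(\<Sum>i\<in>I. sc (c (r i)) (r i)) j = (\<Sum>i\<in>I. sc (c (r i)) (r i) j)"
        by (induction I rule: infinite_finite_induct) auto
      then show ?thesis using sum0 by (simp add: sc_def)
    qed
    \<comment> \<open>Multiplying a vanishing combination of rows by \<open>B\<close> isolates the
      coefficient of row \<open>l\<close>.\<close>
    have "0 = T (\<lambda>j. \<Sum>i\<in>I. c (r i) * r i j) l"
      by (simp add: T_def pt)
    also have "\<dots> = (\<Sum>i\<in>I. c (r i) * T (r i) l)"
      unfolding T_def by (simp add: sum_distrib_left sum_distrib_right mult.assoc) (rule sum.swap)
    also have "\<dots> = (\<Sum>i\<in>I. if i = l then c (r i) else 0)"
      using l by (intro sum.cong) (auto simp: T_r)
    also have "\<dots> = c (r l)" using l fin by simp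
    finally show "c x = 0" using l by simp
  qed (use fin in simp)
  moreover have "r ` I \<subseteq> span (e ` J)"
  proof clarify
    fix i assume "i \<in> I"
    have "r i = (\<Sum>j\<in>J. sc (A i j) (e j))"
    proof
      fix l
      have "(\<Sum>j\<in>J. sc (A i j) (e j)) l = (\<Sum>j\<in>J. sc (A i j) (e j) l)"
        by (induction J rule: infinite_finite_induct) auto
      also have "\<dots> = (\<Sum>j\<in>J. if l = j then A i j else 0)"
        by (intro sum.cong) (auto simp: sc_def e_def)
      also have "\<dots> = r i l" using fin by (simp add: r_def)
      finally show "r i l = (\<Sum>j\<in>J. sc (A i j) (e j)) l" by simp
    qed
    also have "\<dots> \<in> span (e ` J)"
      by (intro span_sum span_scale span_base) auto
    finally show "r i \<in> span (e ` J)" .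
  qed
  ultimately have "card (r ` I) \<le> card (e ` J)"
    using independent_span_bound[of "e ` J" "r ` I"] fin by simp
  also have "\<dots> \<le> card J" using fin card_image_le by blast
  finally show ?thesis by (simp add: card_image[OF inj])
qed

text \<open>Induction that removes \<open>P a\<close> from \<open>A\<close> and \<open>Q a\<close>
  from \<open>B\<close>. By the last hypothesis, \<open>Q b\<close> avoids \<open>Q a\<close> for
  every \<open>b\<close> left in \<open>A\<close>, so it survives in the smaller \<open>B\<close>.
  The sets \<open>P a\<close> need not partition \<open>A\<close>, so no equivalence relation has to
  be set up.\<close>

lemma card_le_if_overlapping_classes:
  assumes "finite A" "finite B"
    and "\<And>a. a \<in> A \<Longrightarrow> a \<in> P a"
    and "\<And>a. a \<in> A \<Longrightarrow> Q a \<subseteq> B"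
    and "\<And>a. a \<in> A \<Longrightarrow> card (A \<inter> P a) \<le> card (Q a)"
    and "\<And>a a'. a \<in> A \<Longrightarrow> a' \<in> A \<Longrightarrow> Q a \<inter> Q a' \<noteq> {} \<Longrightarrow> a' \<in> P a"
  shows "card A \<le> card B"
  using assms
proof (induction "card A" arbitrary: A B rule: less_induct)
  case less
  show ?case
  proof (cases "A = {}")
    case False
    then obtain a where a: "a \<in> A" by blast
    let ?A = "A - P a" and ?B = "B - Q a"
    have fQ: "finite (Q a)" by (rule finite_subset[OF less.prems(4)[OF a] less.prems(2)])
    have "card ?A \<le> card ?B"
    proof (rule less.hyps)
      show "card ?A < card A"
        using less.prems(1) less.prems(3)[OF a] a by (intro psubset_card_mono) blast+
      show "card (?A \<inter> P b) \<le> card (Q b)" if "b \<in> ?A" for b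
      proof -
        have "card (?A \<inter> P b) \<le> card (A \<inter> P b)"
          using less.prems(1) by (intro card_mono) auto
        then show ?thesis using less.prems(5)[of b] that by simp
      qed
      show "Q b \<subseteq> ?B" if "b \<in> ?A" for b
        using less.prems(4)[of b] less.prems(6)[OF a, of b] that by blast
      show "b \<in> P b" if "b \<in> ?A" for b
        using less.prems(3) that by blast
      show "c \<in> P b" if "b \<in> ?A" "c \<in> ?A" "Q b \<inter> Q c \<noteq> {}" for b c
        using less.prems(6) that by blast
    qed (use less.prems(1,2) in simp_all)
    moreover have "card A = card ?A + card (A \<inter> P a)"
      using card_Diff_subset_Int[of A "P a"] card_mono[OF less.prems(1), of "A \<inter> P a"] less.prems(1) by simp
    moreover have "card B = card ?B + card (Q a)"
      using less.prems(2) less.prems(4)[OF a] by (simp add: card_Diff_subset[OF fQ] card_mono)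
    ultimately show ?thesis using less.prems(5)[OF a] by linarith
  qed simp
qed

subsection \<open>Augmentation, scaling and restriction\<close>

definition aug :: "('a \<Rightarrow>\<^sub>0 'k::field) \<Rightarrow> 'k" where
  "aug f = (\<Sum>x\<in>keys f. lookup f x)"

definition scal :: "'k::field \<Rightarrow> ('a \<Rightarrow>\<^sub>0 'k) \<Rightarrow> ('a \<Rightarrow>\<^sub>0 'k)" where
  "scal c f = Poly_Mapping.map ((*) c) f"

definition restr :: "'a set \<Rightarrow> ('a \<Rightarrow>\<^sub>0 'k::field) \<Rightarrow> ('a \<Rightarrow>\<^sub>0 'k)" where
  "restr Z f = Poly_Mapping.mapp (\<lambda>x c. c when x \<in> Z) f"

lemma lookup_scal [simp]: "lookup (scal c f) x = c * lookup f x"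
  by (simp add: scal_def Poly_Mapping.map.rep_eq when_def)

lemma lookup_restr [simp]: "lookup (restr Z f) x = (if x \<in> Z then lookup f x else 0)"
  by (simp add: restr_def lookup_mapp when_def in_keys_iff)

lemma keys_restr: "keys (restr Z f) = keys f \<inter> Z"
  by (auto simp: in_keys_iff split: if_splits)

lemma keys_scal_subset: "keys (scal c f) \<subseteq> keys f"
  by (auto simp: in_keys_iff)

lemma restr_add: "restr Z (f + g) = restr Z f + restr Z g"
  by (rule poly_mapping_eqI) (simp add: lookup_add)

lemma scal_add: "scal c (f + g) = scal c f + scal c g"
  by (rule poly_mapping_eqI) (simp add: lookup_add algebra_simps)

lemma scal_scal: "scal c (scal d f) = scal (c * d) f"
  by (rule poly_mapping_eqI) simp

lemma scal_1 [simp]: "scal 1 f = f" and scal_0 [simp]: "scal 0 f = 0"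
  by (rule poly_mapping_eqI, simp)+

lemma scal_sum: "scal c (\<Sum>i\<in>I. f i) = (\<Sum>i\<in>I. scal c (f i))"
  by (rule poly_mapping_eqI) (simp add: lookup_sum sum_distrib_left)

lemma sum_scal: "(\<Sum>i\<in>I. scal (c i) f) = scal (\<Sum>i\<in>I. c i) f"
  by (rule poly_mapping_eqI) (simp add: lookup_sum sum_distrib_right)

lemma scal_single: "scal c (single x a) = single x (c * a)"
  by (rule poly_mapping_eqI) (simp add: lookup_single when_def)

lemma restr_scal: "restr Z (scal c f) = scal c (restr Z f)"
  by (rule poly_mapping_eqI) simp

lemma restr_restr: "restr Z (restr W f) = restr (Z \<inter> W) f"
  by (rule poly_mapping_eqI) simp

lemma restr_id: "keys f \<subseteq> Z \<Longrightarrow> restr Z f = f"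
  by (rule poly_mapping_eqI) (auto simp: in_keys_iff)

lemma restr_disjoint: "keys f \<inter> Z = {} \<Longrightarrow> restr Z f = 0"
  by (rule poly_mapping_eqI) (auto simp: in_keys_iff)

lemma aug_superset: "finite A \<Longrightarrow> keys f \<subseteq> A \<Longrightarrow> aug f = (\<Sum>x\<in>A. lookup f x)"
  unfolding aug_def by (rule sum.mono_neutral_left) (auto simp: in_keys_iff)

lemma aug_add: "aug (f + g) = aug f + aug g"
proof -
  have "keys (f + g) \<subseteq> keys f \<union> keys g" by (rule keys_add)
  then show ?thesis
    by (simp add: aug_superset[of "keys f \<union> keys g"] lookup_add sum.distrib)
qed

lemma aug_0 [simp]: "aug 0 = 0"
  by (simp add: aug_def)

lemma aug_sum: "aug (\<Sum>i\<in>I. f i) = (\<Sum>i\<in>I. aug (f i))"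
  by (induction I rule: infinite_finite_induct) (auto simp: aug_add)

lemma aug_single [simp]: "aug (single x a) = a"
  by (simp add: aug_def)

lemma sum_singles:
  assumes "finite A" "keys f \<subseteq> A"
  shows "f = (\<Sum>x\<in>A. single x (lookup f x))"
proof (rule poly_mapping_eqI)
  fix y
  have "(\<Sum>x\<in>A. lookup f x when x = y) = (lookup f y when y \<in> A)"
    using assms(1) by (simp add: when_def)
  then show "lookup f y = lookup (\<Sum>x\<in>A. single x (lookup f x)) y"
    using assms by (auto simp: lookup_sum lookup_single when_def in_keys_iff)
qed

section \<open>Products in the quandle ring\<close>

lemma mult_superset:
  assumes "finite A" "keys f \<subseteq> A" "finite B" "keys g \<subseteq> B"
  shows "quandle_ring_mult qop f g =
    (\<Sum>x\<in>A. \<Sum>y\<in>B. single (qop x y) (lookup f x * lookup g y))"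
proof -
  have "quandle_ring_mult qop f g =
      (\<Sum>x\<in>keys f. \<Sum>y\<in>B. single (qop x y) (lookup f x * lookup g y))"
    unfolding quandle_ring_mult_def using assms
    by (intro sum.cong refl sum.mono_neutral_left) (auto simp: in_keys_iff)
  also have "\<dots> = (\<Sum>x\<in>A. \<Sum>y\<in>B. single (qop x y) (lookup f x * lookup g y))"
    using assms by (intro sum.mono_neutral_left) (auto simp: in_keys_iff)
  finally show ?thesis .
qed

lemma mult_add_left:
  "quandle_ring_mult qop (f + g) h = quandle_ring_mult qop f h + quandle_ring_mult qop g h"
  using keys_add[of f g]
  by (simp add: mult_superset[of "keys f \<union> keys g" _ "keys h"] lookup_add distrib_right
      single_add sum.distrib)

lemma mult_single_single:
  "quandle_ring_mult qop (single x a) (single y b) = single (qop x y) (a * b)"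
  by (simp add: mult_superset[of "{x}" _ "{y}"])

text \<open>This is why module endomorphisms, defined as merely additive maps, turn out to be
  linear.\<close>

lemma mult_scal_single:
  "quandle_ring_mult qop f (single y a) = scal a (quandle_ring_mult qop f (single y 1))"
  by (simp add: mult_superset[of "keys f" _ "{y}"] scal_sum scal_single mult.commute)

text \<open>A product of basis elements is again a basis element, so both sides are the double sum
  of products of coefficients.\<close>

lemma aug_mult: "aug (quandle_ring_mult qop f g) = aug f * aug g"
  unfolding quandle_ring_mult_def
  by (simp add: aug_sum aug_def[of f] aug_def[of g] sum_product)

lemma keys_quandle_ring_mult: "keys (quandle_ring_mult qop f g) \<subseteq> (\<lambda>(x, y). qop x y) ` (keys f \<times> keys g)"
proof
  fix z assume z: "z \<in> keys (quandle_ring_mult qop f g)"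
  show "z \<in> (\<lambda>(x, y). qop x y) ` (keys f \<times> keys g)"
  proof (rule ccontr)
    assume "\<not> ?thesis"
    then have "lookup (quandle_ring_mult qop f g) z = 0"
      unfolding quandle_ring_mult_def
      by (auto simp: lookup_sum lookup_single when_def intro!: sum.neutral)
    with z show False by (simp add: in_keys_iff)
  qed
qed

subsection \<open>Orbits of a quandle\<close>

abbreviation rmult where "rmult \<equiv> quandle_ring_mult"

text \<open>Functions of pairs cover two uses: ignoring one argument gives invariants of points, and
  matrices give the invariants to which 2-transitivity applies.\<close>

lemma generate_BijGroup_invariant:
  assumes "H \<subseteq> Bij Z"
    and inv: "\<And>h z z'. h \<in> H \<Longrightarrow> z \<in> Z \<Longrightarrow> z' \<in> Z \<Longrightarrow> c (h z) (h z') = c z z'"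
    and "g \<in> generate (BijGroup Z) H"
  shows "g \<in> Bij Z \<and> (\<forall>z\<in>Z. \<forall>z'\<in>Z. c (g z) (g z') = c z z')"
  using assms(3)
proof (induction rule: generate.induct)
  case one
  show ?case
    unfolding BijGroup_def monoid.select_convs by (intro conjI ballI id_Bij) simp
next
  case (incl h)
  then show ?case using assms by blast
next
  case (inv h)
  then have h: "h \<in> Bij Z" using assms(1) by blast
  let ?k = "\<lambda>x\<in>Z. inv_into Z h x"
  have k: "?k z \<in> Z" "h (?k z) = z" if "z \<in> Z" for z
    using h that Bij_inv_into_mem[OF h that] by (auto simp: Bij_def bij_betw_def f_inv_into_f)
  \<comment> \<open>Invariance under the inverse is invariance under \<open>h\<close> at the
    preimages.\<close>
  have "c (?k z) (?k z') = c z z'" if "z \<in> Z" "z' \<in> Z" for z z'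
    using assms(2)[OF inv k(1)[OF that(1)] k(1)[OF that(2)]]
    by (simp only: k(2)[OF that(1)] k(2)[OF that(2)])
  then show ?case
    unfolding inv_BijGroup[OF h] by (intro conjI ballI restrict_inv_into_Bij[OF h])
next
  case (eng g h)
  then show ?case
    using Bij_imp_funcset[of h Z] by (auto simp: BijGroup_def compose_Bij compose_eq Pi_iff)
qed

context quandle
begin

lemma right_cancel: "\<lbrakk>a \<in> X; b \<in> X; x \<in> X; a \<triangleright> x = b \<triangleright> x\<rbrakk> \<Longrightarrow> a = b"
  using right_div[of "a \<triangleright> x" x] closed[of a x] by blast

lemma right_mult_Bij:
  assumes "finite Z" "Z \<subseteq> X" "x \<in> X" "\<And>z. z \<in> Z \<Longrightarrow> z \<triangleright> x \<in> Z"
  shows "right_mult (\<triangleright>) Z x \<in> Bij Z"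
proof -
  have "inj_on (right_mult (\<triangleright>) Z x) Z"
    using assms(2,3) right_cancel[of _ _ x] by (auto simp: inj_on_def right_mult_def subset_iff)
  moreover have "right_mult (\<triangleright>) Z x ` Z \<subseteq> Z"
    using assms by (auto simp: right_mult_def)
  ultimately show ?thesis
    using endo_inj_surj[OF assms(1)] by (auto simp: Bij_def bij_betw_def right_mult_def)
qed

lemma mem_quandle_orbits:
  "Z \<in> quandle_orbits X (\<triangleright>) \<longleftrightarrow> (\<exists>x\<in>X. Z = (\<lambda>g. g x) ` Inn X (\<triangleright>))"
  by (auto simp: quandle_orbits_def orbits_def orbit_def)

lemma Inn_invariant:
  assumes "finite X" "g \<in> Inn X (\<triangleright>)"
    and "\<And>x y. x \<in> X \<Longrightarrow> y \<in> X \<Longrightarrow> f (y \<triangleright> x) = f y"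
  shows "g \<in> Bij X" "\<And>y. y \<in> X \<Longrightarrow> f (g y) = f y"
proof -
  have H: "right_mult (\<triangleright>) X ` X \<subseteq> Bij X"
    using assms(1) closed by (auto intro!: right_mult_Bij)
  have "g \<in> Bij X \<and> (\<forall>y\<in>X. \<forall>z\<in>X. f (g y) = f y)"
    by (rule generate_BijGroup_invariant[OF H])
      (use assms in \<open>auto simp: Inn_def right_mult_def\<close>)
  then show "g \<in> Bij X" "\<And>y. y \<in> X \<Longrightarrow> f (g y) = f y" by auto
qed

lemma orbit_subset:
  assumes "finite X" "Z \<in> quandle_orbits X (\<triangleright>)" shows "Z \<subseteq> X"
  using assms Inn_invariant(1)[of _ "\<lambda>_. ()"] Bij_imp_funcset
  by (fastforce simp: mem_quandle_orbits Pi_iff)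

lemma orbit_nonempty: "Z \<in> quandle_orbits X (\<triangleright>) \<Longrightarrow> Z \<noteq> {}"
  using generate.one[of "BijGroup X"] by (auto simp: mem_quandle_orbits Inn_def)

lemma orbit_finite: "finite X \<Longrightarrow> Z \<in> quandle_orbits X (\<triangleright>) \<Longrightarrow> finite Z"
  using orbit_subset finite_subset by blast

lemma quandle_orbits_finite: "finite X \<Longrightarrow> finite (quandle_orbits X (\<triangleright>))"
  using orbit_subset by (intro finite_subset[of "quandle_orbits X (\<triangleright>)" "Pow X"]) auto

lemma in_some_orbit: "x \<in> X \<Longrightarrow> \<exists>Z\<in>quandle_orbits X (\<triangleright>). x \<in> Z"
proof
  assume x: "x \<in> X"
  show "(\<lambda>g. g x) ` Inn X (\<triangleright>) \<in> quandle_orbits X (\<triangleright>)"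
    using x by (auto simp: mem_quandle_orbits)
  have "\<one>\<^bsub>BijGroup X\<^esub> \<in> Inn X (\<triangleright>)" unfolding Inn_def by (rule generate.one)
  then show "x \<in> (\<lambda>g. g x) ` Inn X (\<triangleright>)"
    using x by (intro image_eqI[of _ _ "\<one>\<^bsub>BijGroup X\<^esub>"]) (auto simp: BijGroup_def)
qed

lemma orbit_closed:
  assumes "finite X" "Z \<in> quandle_orbits X (\<triangleright>)" "z \<in> Z" "x \<in> X"
  shows "z \<triangleright> x \<in> Z"
proof -
  obtain y g where y: "y \<in> X" "Z = (\<lambda>g. g y) ` Inn X (\<triangleright>)" "g \<in> Inn X (\<triangleright>)" "z = g y"
    using assms(2,3) by (auto simp: mem_quandle_orbits)
  let ?R = "right_mult (\<triangleright>) X x"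
  have R: "?R \<in> Inn X (\<triangleright>)" "?R \<in> Bij X" 
    using assms closed by (auto simp: Inn_def intro!: generate.incl right_mult_Bij)
  have g: "g \<in> Bij X" using Inn_invariant(1)[OF assms(1) y(3), of "\<lambda>_. ()"] by simp
  have "?R \<otimes>\<^bsub>BijGroup X\<^esub> g \<in> Inn X (\<triangleright>)"
    using R(1) y(3) unfolding Inn_def by (rule generate.eng)
  moreover have "(?R \<otimes>\<^bsub>BijGroup X\<^esub> g) y = z \<triangleright> x"
    using R g y Bij_imp_funcset[OF g] by (auto simp: BijGroup_def compose_eq right_mult_def)
  ultimately show ?thesis unfolding y(2) by (metis image_eqI)
qed

lemma orbit_constant:
  assumes "finite X" "Z \<in> quandle_orbits X (\<triangleright>)" "z \<in> Z" "z' \<in> Z"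
    and "\<And>x y. x \<in> X \<Longrightarrow> y \<in> X \<Longrightarrow> f (y \<triangleright> x) = f y"
  shows "f z = f z'"
  using assms(2-4) Inn_invariant(2)[OF assms(1) _ assms(5)] by (auto simp: mem_quandle_orbits)

text \<open>Right multiplication by \<open>x\<close> maps the finite set \<open>Z\<close>
  injectively into itself, hence onto itself; by cancellation no point outside \<open>Z\<close> can
  be sent into \<open>Z\<close>.\<close>

lemma orbit_mem_right_mult:
  assumes "finite X" "Z \<in> quandle_orbits X (\<triangleright>)" "x \<in> X" "y \<in> X"
  shows "y \<triangleright> x \<in> Z \<longleftrightarrow> y \<in> Z"
proof
  assume "y \<triangleright> x \<in> Z"
  moreover have "right_mult (\<triangleright>) Z x ` Z = Z"
    using right_mult_Bij[of Z x] assms orbit_subset orbit_finite orbit_closed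
    by (simp add: Bij_def bij_betw_def)
  ultimately obtain z where "z \<in> Z" "y \<triangleright> x = z \<triangleright> x"
    by (auto simp: right_mult_def)
  then show "y \<in> Z"
    using right_cancel[of y z x] assms orbit_subset by blast
qed (use assms orbit_closed in blast)

text \<open>Membership in one orbit is invariant under right multiplication, hence constant on every
  other orbit.\<close>

lemma orbits_disjoint:
  assumes "finite X" "Z \<in> quandle_orbits X (\<triangleright>)" "W \<in> quandle_orbits X (\<triangleright>)" "Z \<noteq> W"
  shows "Z \<inter> W = {}"
proof (rule ccontr)
  assume "Z \<inter> W \<noteq> {}"
  then obtain y where y: "y \<in> Z" "y \<in> W" by blast
  have "w \<in> Z" if "w \<in> W" for w
    using orbit_constant[OF assms(1,3) that y(2), of "\<lambda>w. w \<in> Z"]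
      orbit_mem_right_mult[OF assms(1,2)] y by blast
  moreover have "w \<in> W" if "w \<in> Z" for w
    using orbit_constant[OF assms(1,2) that y(1), of "\<lambda>w. w \<in> W"]
      orbit_mem_right_mult[OF assms(1,3)] y by blast
  ultimately show False using assms(4) by blast
qed

lemma Union_quandle_orbits: "finite X \<Longrightarrow> \<Union> (quandle_orbits X (\<triangleright>)) = X"
  by (intro subset_antisym Union_least orbit_subset subsetI) (auto dest: in_some_orbit)

text \<open>The one place where 2-transitivity enters. It will be applied to the matrix of a module
  endomorphism.\<close>

lemma orbit_pair_constant:
  assumes "finite X" "Z \<in> quandle_orbits X (\<triangleright>)" "orbit_two_transitive X (\<triangleright>)"
    and inv: "\<And>x z z'. x \<in> X \<Longrightarrow> z \<in> Z \<Longrightarrow> z' \<in> Z \<Longrightarrow> c (z \<triangleright> x) (z' \<triangleright> x) = c z z'"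
    and mem: "z1 \<in> Z" "z1' \<in> Z" "z2 \<in> Z" "z2' \<in> Z" and ne: "z1 \<noteq> z1'" "z2 \<noteq> z2'"
  shows "c z1 z1' = c z2 z2'"
proof -
  obtain g where g: "g \<in> orbit_group X (\<triangleright>) Z" "g z1 = z2" "g z1' = z2'"
    using bspec[OF assms(3)[unfolded orbit_two_transitive_def] assms(2)] mem ne
    unfolding two_transitive_def by meson
  have H: "right_mult (\<triangleright>) Z ` X \<subseteq> Bij Z"
    using orbit_closed[OF assms(1,2)] orbit_subset[OF assms(1,2)] orbit_finite[OF assms(1,2)]
    by (auto intro!: right_mult_Bij)
  have "g \<in> Bij Z \<and> (\<forall>z\<in>Z. \<forall>z'\<in>Z. c (g z) (g z') = c z z')"
    by (rule generate_BijGroup_invariant[OF H])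
      (use g inv in \<open>auto simp: orbit_group_def right_mult_def\<close>)
  then show ?thesis using g mem by metis
qed

lemma rmult_mem:
  "f \<in> quandle_ring X \<Longrightarrow> g \<in> quandle_ring X \<Longrightarrow> rmult (\<triangleright>) f g \<in> quandle_ring X"
  using keys_quandle_ring_mult[of "(\<triangleright>)" f g] closed unfolding quandle_ring_def by force

text \<open>By cancellation, \<open>y\<close> is the only basis element that right multiplication by
  \<open>x\<close> sends to \<open>y \<triangleright> x\<close>.\<close>

lemma lookup_rmult_single:
  assumes "finite X" "f \<in> quandle_ring X" "x \<in> X" "y \<in> X"
  shows "lookup (rmult (\<triangleright>) f (single x b)) (y \<triangleright> x) = lookup f y * b"
proof -
  have "lookup (rmult (\<triangleright>) f (single x b)) (y \<triangleright> x) =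
      (\<Sum>z\<in>X. if z = y then lookup f z * b else 0)"
    using assms right_cancel[of _ y x]
    by (auto simp: mult_superset[of X _ "{x}"] quandle_ring_def lookup_sum lookup_single when_def
        simp del: sum.delta intro!: sum.cong)
  then show ?thesis using assms by simp
qed

text \<open>Right translations preserve both \<open>Z\<close> and its complement. So
  \<open>k[X]\<close> splits as a right module into the \<open>k[Z]\<close>, and
  \<open>restr Z\<close> is a module projection.\<close>

lemma restr_rmult:
  assumes "finite X" "Z \<in> quandle_orbits X (\<triangleright>)" "f \<in> quandle_ring X" "g \<in> quandle_ring X"
  shows "restr Z (rmult (\<triangleright>) f g) = rmult (\<triangleright>) (restr Z f) g"
proof -
  have f: "f = restr Z f + restr (X - Z) f"
    using assms(3) orbit_subset[OF assms(1,2)]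
    by (intro poly_mapping_eqI) (auto simp: lookup_add quandle_ring_def in_keys_iff)
  have "keys (rmult (\<triangleright>) (restr Z f) g) \<subseteq> Z"
    using keys_quandle_ring_mult[of "(\<triangleright>)" "restr Z f" g] orbit_closed[OF assms(1,2)] assms(4)
    by (force simp: keys_restr quandle_ring_def)
  moreover have "keys (rmult (\<triangleright>) (restr (X - Z) f) g) \<inter> Z = {}"
    using keys_quandle_ring_mult[of "(\<triangleright>)" "restr (X - Z) f" g] orbit_mem_right_mult[OF assms(1,2)] assms(4)
    by (force simp: keys_restr quandle_ring_def)
  ultimately show ?thesis
    by (subst f) (simp add: mult_add_left restr_add restr_id restr_disjoint)
qed

end

subsection \<open>Maps of right modules\<close>

text \<open>A map of right modules along the ring map \<open>\<psi>\<close>. With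
  \<open>\<psi>\<close> the identity these are the module endomorphisms, and a ring isomorphism is
  such a map along itself. Linearity over the field is not demanded, since ring isomorphisms may
  lack it.\<close>

definition right_hom ::
    "'a set \<Rightarrow> ('a \<Rightarrow> 'a \<Rightarrow> 'a) \<Rightarrow> 'b set \<Rightarrow> ('b \<Rightarrow> 'b \<Rightarrow> 'b) \<Rightarrow>
      (('a \<Rightarrow>\<^sub>0 'k::field) \<Rightarrow> ('b \<Rightarrow>\<^sub>0 'k)) \<Rightarrow> (('a \<Rightarrow>\<^sub>0 'k) \<Rightarrow> ('b \<Rightarrow>\<^sub>0 'k)) \<Rightarrow> bool" where
  "right_hom X opX Y opY \<psi> F \<longleftrightarrow>
     (\<forall>u\<in>quandle_ring X. F u \<in> quandle_ring Y \<and>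
        (\<forall>v\<in>quandle_ring X.
           F (u + v) = F u + F v \<and> F (rmult opX u v) = rmult opY (F u) (\<psi> v)))"

lemma quandle_ring_0 [simp]: "0 \<in> quandle_ring X"
  by (simp add: quandle_ring_def)

lemma quandle_ring_add: "u \<in> quandle_ring X \<Longrightarrow> v \<in> quandle_ring X \<Longrightarrow> u + v \<in> quandle_ring X"
  using keys_add[of u v] by (auto simp: quandle_ring_def)

lemma quandle_ring_sum: "(\<And>i. i \<in> I \<Longrightarrow> u i \<in> quandle_ring X) \<Longrightarrow> sum u I \<in> quandle_ring X"
  by (induction I rule: infinite_finite_induct) (auto intro: quandle_ring_add)

lemma quandle_ring_scal: "u \<in> quandle_ring X \<Longrightarrow> scal c u \<in> quandle_ring X"
  using keys_scal_subset[of c u] by (auto simp: quandle_ring_def)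

lemma quandle_ring_restr: "u \<in> quandle_ring X \<Longrightarrow> restr Z u \<in> quandle_ring X"
  by (auto simp: quandle_ring_def keys_restr)

lemma quandle_ring_single: "x \<in> X \<Longrightarrow> single x a \<in> quandle_ring X"
  by (simp add: quandle_ring_def)

lemma rmult_scal_left: "rmult qop (scal c u) v = scal c (rmult qop u v)"
  using keys_scal_subset[of c u]
  by (simp add: mult_superset[of "keys u" _ "keys v"] scal_sum scal_single mult.assoc)

context
  fixes X :: "'a set" and opX Y and opY :: "'b \<Rightarrow> 'b \<Rightarrow> 'b"
    and \<psi> F :: "('a \<Rightarrow>\<^sub>0 'k::field) \<Rightarrow> ('b \<Rightarrow>\<^sub>0 'k)"
  assumes hom: "right_hom X opX Y opY \<psi> F"
begin

lemma right_hom_mem: "u \<in> quandle_ring X \<Longrightarrow> F u \<in> quandle_ring Y"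
  using hom by (simp add: right_hom_def)

lemma right_hom_add: "u \<in> quandle_ring X \<Longrightarrow> v \<in> quandle_ring X \<Longrightarrow> F (u + v) = F u + F v"
  using hom by (simp add: right_hom_def)

lemma right_hom_mult:
  "u \<in> quandle_ring X \<Longrightarrow> v \<in> quandle_ring X \<Longrightarrow> F (rmult opX u v) = rmult opY (F u) (\<psi> v)"
  using hom by (simp add: right_hom_def)

lemma right_hom_0: "F 0 = 0"
  using right_hom_add[of 0 0] by simp

lemma right_hom_sum:
  "(\<And>i. i \<in> I \<Longrightarrow> u i \<in> quandle_ring X) \<Longrightarrow> F (sum u I) = (\<Sum>i\<in>I. F (u i))"
  by (induction I rule: infinite_finite_induct)
    (auto simp: right_hom_0 right_hom_add quandle_ring_sum)

lemma right_hom_expand: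
  assumes "Z \<subseteq> X" "finite Z" "keys u \<subseteq> Z"
  shows "F u = (\<Sum>x\<in>Z. F (single x (lookup u x)))"
  using assms(1) sum_singles[OF assms(2,3)]
    right_hom_sum[of Z "\<lambda>x. single x (lookup u x)"]
  by (metis quandle_ring_single subsetD)

end

text \<open>The twist \<open>\<psi>''\<close> has to agree with the composite on the quandle ring
  only, so that an isomorphism followed by its inverse yields the identity twist.\<close>

lemma right_hom_comp:
  assumes "right_hom X opX Y opY \<psi> F" "right_hom Y opY Z opZ \<psi>' G"
    and "\<And>v. v \<in> quandle_ring X \<Longrightarrow> \<psi> v \<in> quandle_ring Y"
    and "\<And>v. v \<in> quandle_ring X \<Longrightarrow> \<psi>' (\<psi> v) = \<psi>'' v"
  shows "right_hom X opX Z opZ \<psi>'' (\<lambda>u. G (F u))"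
  using assms by (auto simp: right_hom_def)

lemma right_hom_scal: "right_hom X opX X opX (\<lambda>v. v) (scal c)"
  by (auto simp: right_hom_def quandle_ring_scal scal_add rmult_scal_left)

lemma (in quandle) right_hom_restr:
  assumes "finite X" "Z \<in> quandle_orbits X (\<triangleright>)"
  shows "right_hom X (\<triangleright>) X (\<triangleright>) (\<lambda>v. v) (restr Z)"
  using assms by (auto simp: right_hom_def quandle_ring_restr restr_add restr_rmult)

lemma iso_right_hom:
  "\<psi> \<in> quandle_ring_iso X opX Y opY \<Longrightarrow> right_hom X opX Y opY \<psi> \<psi>"
  by (auto simp: right_hom_def quandle_ring_iso_def bij_betw_def)

section \<open>Ring isomorphisms and their effect on augmentations\<close>

lemma (in quandle) inv_iso:
  assumes "\<psi> \<in> quandle_ring_iso X (\<triangleright>) Y opY"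
  shows "inv_into (quandle_ring X) \<psi> \<in> quandle_ring_iso Y opY X (\<triangleright>)"
proof -
  let ?i = "inv_into (quandle_ring X) \<psi>"
  have bij: "bij_betw \<psi> (quandle_ring X) (quandle_ring Y)"
    using assms by (simp add: quandle_ring_iso_def)
  note r = bij_betw_inv_into[OF bij]
  have mem: "?i u \<in> quandle_ring X" and inv: "\<psi> (?i u) = u" if "u \<in> quandle_ring Y" for u
    using r that bij by (auto simp: bij_betw_def f_inv_into_f)
  have left: "?i (\<psi> u) = u" if "u \<in> quandle_ring X" for u
    using bij that by (simp add: bij_betw_def)
  have "?i (f + g) = ?i f + ?i g" "?i (rmult opY f g) = rmult (\<triangleright>) (?i f) (?i g)"
    if "f \<in> quandle_ring Y" "g \<in> quandle_ring Y" for f g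
  proof -
    have "\<psi> (?i f + ?i g) = f + g" "\<psi> (rmult (\<triangleright>) (?i f) (?i g)) = rmult opY f g"
      using assms mem[OF that(1)] mem[OF that(2)] inv[OF that(1)] inv[OF that(2)]
      by (auto simp: quandle_ring_iso_def)
    then show "?i (f + g) = ?i f + ?i g" "?i (rmult opY f g) = rmult (\<triangleright>) (?i f) (?i g)"
      using left[of "?i f + ?i g"] left[of "rmult (\<triangleright>) (?i f) (?i g)"] mem that
      by (auto simp: quandle_ring_add rmult_mem)
  qed
  then show ?thesis using r by (simp add: quandle_ring_iso_def)
qed

text \<open>By idempotence, \<open>a x\<close> is the product of \<open>x\<close> and
  \<open>a x\<close>.\<close>

lemma (in quandle) right_hom_single:
  assumes "right_hom X (\<triangleright>) Y opY \<psi> F" "x \<in> X"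
  shows "F (single x a) = rmult opY (F (single x 1)) (\<psi> (single x a))"
  using right_hom_mult[OF assms(1), of "single x 1" "single x a"] assms(2)
  by (simp add: quandle_ring_single mult_single_single idem)

text \<open>Restricted to the multiples of a basis element, a homomorphism to the field is zero or a field
  homomorphism; if it vanishes at one basis element \<open>x\<close>, it vanishes on all products \<open>z \<triangleright> x\<close>, so
  everywhere.\<close>

lemma (in quandle) iso_aug:
  fixes \<psi> :: "('a \<Rightarrow>\<^sub>0 'k::field) \<Rightarrow> ('b \<Rightarrow>\<^sub>0 'k)"
  assumes iso: "\<psi> \<in> quandle_ring_iso X (\<triangleright>) Y opY" and fin: "finite X"
  obtains \<tau> :: "'k \<Rightarrow> 'k" where "\<tau> 0 = 0" "\<tau> 1 = 1" "\<And>a b. \<tau> (a + b) = \<tau> a + \<tau> b"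
    "\<And>u. u \<in> quandle_ring X \<Longrightarrow> aug (\<psi> u) = \<tau> (aug u)"
proof (cases "X = {}")
  case True
  note hom = iso_right_hom[OF iso]
  have "aug (\<psi> u) = aug u" if "u \<in> quandle_ring X" for u
    using that True right_hom_0[OF hom] by (simp add: quandle_ring_def)
  then show ?thesis using that[of "\<lambda>a. a"] by simp
next
  case False
  then obtain x0 where x0: "x0 \<in> X" by blast
  note hom = iso_right_hom[OF iso]
  have bij: "bij_betw \<psi> (quandle_ring X) (quandle_ring Y)"
    using iso by (simp add: quandle_ring_iso_def)
  let ?c = "\<lambda>x a. aug (\<psi> (single x a))"
  have mult: "?c (x \<triangleright> y) (a * b) = ?c x a * ?c y b" if "x \<in> X" "y \<in> X" for x y a b
    using right_hom_mult[OF hom, of "single x a" "single y b"] that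
    by (simp add: quandle_ring_single mult_single_single aug_mult)
  have sing: "aug (\<psi> u) = (\<Sum>x\<in>X. ?c x (lookup u x))" if "u \<in> quandle_ring X" for u
    using that sum_singles[OF fin, of u]
      right_hom_sum[OF hom, of X "\<lambda>x. single x (lookup u x)"]
    by (simp add: quandle_ring_def aug_sum)
  have one: "?c x 1 = 1" if x: "x \<in> X" for x
  proof (rule ccontr)
    assume "?c x 1 \<noteq> 1"
    moreover have "?c x 1 * ?c x 1 = ?c x 1"
      using mult[OF x x, of 1 1] idem[OF x] by simp
    ultimately have zero: "?c x 1 = 0" by simp
    have "?c y a = 0" if y: "y \<in> X" for y a
    proof -
      obtain z where "z \<in> X" "y = z \<triangleright> x" using right_div[OF y x] by blast
      then show ?thesis using mult[of z x a 1] x zero by simp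
    qed
    then have aug0: "aug (\<psi> u) = 0" if "u \<in> quandle_ring X" for u
      using sing[OF that] by simp
    \<comment> \<open>By injectivity some image is nonzero, so \<open>Y\<close> has an element. The
      corresponding basis element has augmentation 1 and is itself an image, against
      \<open>aug0\<close>.\<close>
    have "\<psi> (single x 1) \<noteq> 0"
    proof
      assume "\<psi> (single x 1) = 0"
      then have "\<psi> (single x 1) = \<psi> 0" using right_hom_0[OF hom] by simp
      then have "single x (1::'k) = 0"
        using bij quandle_ring_single[OF x] quandle_ring_0
        by (meson bij_betw_imp_inj_on inj_onD)
      then show False by (metis lookup_single_eq lookup_zero zero_neq_one)
    qed
    then obtain y where "y \<in> keys (\<psi> (single x 1))" by fastforce
    moreover have "\<psi> (single x 1) \<in> quandle_ring Y"
      using right_hom_mem[OF hom] x by (simp add: quandle_ring_single)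
    ultimately have "single y 1 \<in> quandle_ring Y" by (auto simp: quandle_ring_def)
    then obtain v where "v \<in> quandle_ring X" "\<psi> v = single y 1"
      using bij by (metis bij_betw_iff_bijections)
    then show False using aug0[of v] by simp
  qed
  define \<tau> where "\<tau> = ?c x0"
  have indep: "?c x a = \<tau> a" if x: "x \<in> X" for x a
  proof -
    \<comment> \<open>The product of \<open>x0\<close> and \<open>x\<close> is computed with the
      scalar \<open>a\<close> on either factor; comparing the two removes the dependence on the
      basis element.\<close>
    have "?c (x0 \<triangleright> x) a = ?c x0 1 * ?c x a" "?c (x0 \<triangleright> x) a = ?c x0 a * ?c x 1"
      using mult[OF x0 x, of 1 a] mult[OF x0 x, of a 1] by simp_all
    then show ?thesis using one x x0 by (simp add: \<tau>_def)
  qed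
  show ?thesis
  proof (rule that)
    show z: "\<tau> 0 = 0" using right_hom_0[OF hom] by (simp add: \<tau>_def)
    show "\<tau> 1 = 1" using one x0 by (simp add: \<tau>_def)
    show add: "\<tau> (a + b) = \<tau> a + \<tau> b" for a b
      using right_hom_add[OF hom, of "single x0 a" "single x0 b"] x0
      by (simp add: \<tau>_def quandle_ring_single single_add aug_add)
    show "aug (\<psi> u) = \<tau> (aug u)" if "u \<in> quandle_ring X" for u
    proof -
      have "\<tau> (sum f I) = (\<Sum>i\<in>I. \<tau> (f i))" for f :: "'a \<Rightarrow> 'k" and I
        by (induction I rule: infinite_finite_induct) (auto simp: z add)
      then show ?thesis
        using sing[OF that] indep that
        by (simp add: aug_superset[OF fin] quandle_ring_def)
    qed
  qed
qed

section \<open>Augmentation-zero parts under module maps\<close>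

definition delta :: "'a set \<Rightarrow> ('a \<Rightarrow>\<^sub>0 'k::field) set" where
  "delta Z = {u. keys u \<subseteq> Z \<and> aug u = 0}"

text \<open>The augmentation of the \<open>W\<close>-part of \<open>F\<close> turns right
  multiplication by \<open>g\<close> into multiplication by \<open>\<tau> (aug g)\<close>. With
  \<open>g\<close> a basis element this shows that its value at basis elements is constant on
  orbits. The map \<open>\<tau>\<close> is fixed beforehand so that all \<open>W\<close> share
  it.\<close>

lemma right_hom_aug:
  fixes \<psi> F :: "('a \<Rightarrow>\<^sub>0 'k::field) \<Rightarrow> ('b \<Rightarrow>\<^sub>0 'k)" and \<tau> :: "'k \<Rightarrow> 'k"
  assumes X: "quandle X opX" "finite X"
    and Y: "quandle Y opY" "finite Y" "W \<in> quandle_orbits Y opY"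
    and iso: "\<psi> \<in> quandle_ring_iso X opX Y opY"
    and hom: "right_hom X opX Y opY \<psi> F"
    and \<tau>: "\<tau> 0 = 0" "\<tau> 1 = 1" "\<And>a b. \<tau> (a + b) = \<tau> a + \<tau> b"
      "\<And>u. u \<in> quandle_ring X \<Longrightarrow> aug (\<psi> u) = \<tau> (aug u)"
  shows "\<exists>c. \<forall>Z\<in>quandle_orbits X opX. \<forall>u. keys u \<subseteq> Z \<longrightarrow>
    aug (restr W (F u)) = c Z * \<tau> (aug u)"
proof -
  interpret X: quandle X opX by fact
  interpret Y: quandle Y opY by fact
  have \<tau>_sum: "\<tau> (sum f I) = (\<Sum>i\<in>I. \<tau> (f i))" for f :: "'a \<Rightarrow> 'k" and I
    by (induction I rule: infinite_finite_induct) (auto simp: \<tau>)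
  note mem = right_hom_mem[OF hom] and mem\<psi> = right_hom_mem[OF iso_right_hom[OF iso]]
  define c where "c = (\<lambda>x. aug (restr W (F (single x 1))))"
  have aug: "aug (restr W (F (rmult opX v g))) = aug (restr W (F v)) * \<tau> (aug g)"
    if "v \<in> quandle_ring X" "g \<in> quandle_ring X" for v g
    using that right_hom_mult[OF hom that] mem mem\<psi>
    by (simp add: aug_mult \<tau> Y.restr_rmult[OF Y(2,3)])
  have c: "aug (restr W (F (single x a))) = c x * \<tau> a" if "x \<in> X" for x a
    using aug[of "single x 1" "single x a"] that
    by (simp add: c_def quandle_ring_single mult_single_single X.idem)
  have c_inv: "c (opX y x) = c y" if "x \<in> X" "y \<in> X" for x y
    using aug[of "single y 1" "single x 1"] that
    by (simp add: c_def quandle_ring_single mult_single_single \<tau>)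
  have "aug (restr W (F u)) = c (SOME z. z \<in> Z) * \<tau> (aug u)"
    if orb: "Z \<in> quandle_orbits X opX" and u: "keys u \<subseteq> Z" for Z u
  proof -
    let ?z = "SOME z. z \<in> Z"
    have z: "?z \<in> Z" using X.orbit_nonempty[OF orb] by (simp add: some_in_eq)
    have Z: "Z \<subseteq> X" "finite Z" using X.orbit_subset X.orbit_finite X orb by auto
    have "F u = (\<Sum>x\<in>Z. F (single x (lookup u x)))"
      by (rule right_hom_expand[OF hom Z u])
    then have "restr W (F u) = (\<Sum>x\<in>Z. restr W (F (single x (lookup u x))))"
      by (auto simp: lookup_sum intro!: poly_mapping_eqI)
    then have "aug (restr W (F u)) = (\<Sum>x\<in>Z. c x * \<tau> (lookup u x))"
      using Z(1) by (auto simp: aug_sum c intro!: sum.cong)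
    also have "\<dots> = (\<Sum>x\<in>Z. c ?z * \<tau> (lookup u x))"
      using X.orbit_constant[OF X(2) orb _ z c_inv] by (intro sum.cong) auto
    also have "\<dots> = c ?z * \<tau> (aug u)"
      by (simp add: \<tau>_sum sum_distrib_left aug_superset[OF Z(2) u])
    finally show ?thesis .
  qed
  then show ?thesis by (intro exI[of _ "\<lambda>Z. c (SOME z. z \<in> Z)"]) blast
qed

text \<open>The augmentation of the image is a multiple of \<open>\<tau> 0\<close>, hence
  zero.\<close>

lemma right_hom_delta:
  fixes \<psi> F :: "('a \<Rightarrow>\<^sub>0 'k::field) \<Rightarrow> ('b \<Rightarrow>\<^sub>0 'k)"
  assumes X: "quandle X opX" "finite X" "Z \<in> quandle_orbits X opX"
    and Y: "quandle Y opY" "finite Y" "W \<in> quandle_orbits Y opY"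
    and iso: "\<psi> \<in> quandle_ring_iso X opX Y opY"
    and hom: "right_hom X opX Y opY \<psi> F" and u: "u \<in> delta Z"
  shows "restr W (F u) \<in> delta W"
proof -
  obtain \<tau> where \<tau>: "\<tau> 0 = 0" "\<tau> 1 = 1" "\<And>a b. \<tau> (a + b) = \<tau> a + \<tau> b"
    "\<And>u. u \<in> quandle_ring X \<Longrightarrow> aug (\<psi> u) = \<tau> (aug u)"
    using quandle.iso_aug[OF X(1) iso X(2)] by metis
  show ?thesis
    using right_hom_aug[OF X(1,2) Y iso hom \<tau>] X(3) u by (auto simp: delta_def keys_restr \<tau>(1))
qed

text \<open>Linearity comes from idempotence: \<open>F (a x)\<close> is \<open>F x\<close> times
  \<open>a x\<close>, which is \<open>a\<close> times the product of \<open>F x\<close> and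
  \<open>x\<close>, and that product is \<open>F x\<close>.\<close>

lemma (in quandle) endo_single:
  assumes "right_hom X (\<triangleright>) X (\<triangleright>) (\<lambda>v. v) F" "x \<in> X"
  shows "F (single x a) = scal a (F (single x 1))"
  using right_hom_single[OF assms, of a] right_hom_single[OF assms, of 1]
    mult_scal_single[of "(\<triangleright>)" "F (single x 1)" x a] by simp

text \<open>The matrix of \<open>F\<close> is invariant under simultaneous right translation of both
  indices. On \<open>Z\<close> it therefore has one diagonal and one off-diagonal value, so it
  combines the identity with the all-ones matrix, and the latter kills
  \<open>delta Z\<close>.\<close>

lemma (in quandle) endo_scalar_on_delta:
  fixes F :: "('a \<Rightarrow>\<^sub>0 'k::field) \<Rightarrow> ('a \<Rightarrow>\<^sub>0 'k)"
  assumes "finite X" "orbit_two_transitive X (\<triangleright>)" "Z \<in> quandle_orbits X (\<triangleright>)"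
    and hom: "right_hom X (\<triangleright>) X (\<triangleright>) (\<lambda>v. v) F"
  shows "\<exists>a. \<forall>u\<in>delta Z. restr Z (F u) = scal a u"
proof (cases "\<exists>z\<in>Z. \<exists>z'\<in>Z. z \<noteq> z'")
  case False
  then obtain z where z: "Z = {z}" using orbit_nonempty[OF assms(3)] by blast
  \<comment> \<open>On a one-point orbit \<open>delta Z\<close> is zero, so any scalar
    serves.\<close>
  have "u = 0" if "u \<in> delta Z" for u :: "'a \<Rightarrow>\<^sub>0 'k"
    using that aug_superset[of Z u] z by (auto simp: delta_def in_keys_iff intro!: poly_mapping_eqI)
  then show ?thesis using right_hom_0[OF hom] by (metis restr_disjoint scal_0 inf_bot_left keys_zero)
next
  case True
  then obtain z z' where z: "z \<in> Z" "z' \<in> Z" "z \<noteq> z'" by blast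
  define c where "c = (\<lambda>x y. lookup (F (single x 1)) y)"
  have Z: "Z \<subseteq> X" "finite Z" using orbit_subset orbit_finite assms by auto
  have c_inv: "c (y \<triangleright> x) (y' \<triangleright> x) = c y y'" if "x \<in> X" "y \<in> X" "y' \<in> X" for x y y'
  proof -
    have "F (single (y \<triangleright> x) 1) = rmult (\<triangleright>) (F (single y 1)) (single x 1)"
      using right_hom_mult[OF hom, of "single y 1" "single x 1"] that
      by (simp add: quandle_ring_single mult_single_single)
    then show ?thesis
      using lookup_rmult_single[OF assms(1), of "F (single y 1)" x y' 1] that
        right_hom_mem[OF hom, of "single y 1"]
      by (simp add: c_def quandle_ring_single)
  qed
  have diag: "c x x = c z z" if "x \<in> Z" for x
    using orbit_constant[OF assms(1,3) that z(1), of "\<lambda>x. c x x"] c_inv by blast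
  have off: "c x y = c z z'" if "x \<in> Z" "y \<in> Z" "x \<noteq> y" for x y
    using orbit_pair_constant[OF assms(1,3,2) _ that(1,2) z(1,2) that(3) z(3), of c] c_inv Z(1)
    by blast
  have F: "lookup (F (single x a)) y = a * c x y" if "x \<in> X" for x y a
    by (simp add: c_def endo_single[OF hom that, of a])
  have "restr Z (F u) = scal (c z z - c z z') u" if u: "u \<in> delta Z" for u
  proof (rule poly_mapping_eqI)
    fix y
    show "lookup (restr Z (F u)) y = lookup (scal (c z z - c z z') u) y"
    proof (cases "y \<in> Z")
      case False
      then show ?thesis using u by (auto simp: delta_def in_keys_iff)
    next
      case y: True
      have "F u = (\<Sum>x\<in>Z. F (single x (lookup u x)))"
        using u by (intro right_hom_expand[OF hom Z]) (simp add: delta_def)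
      then have "lookup (F u) y = (\<Sum>x\<in>Z. lookup u x * c x y)"
        using Z(1) by (auto simp: lookup_sum F intro!: sum.cong)
      \<comment> \<open>Each entry is the off-diagonal value plus a correction on the diagonal; the
        constant part contributes a multiple of \<open>aug u\<close>.\<close>
      also have "\<dots> = (\<Sum>x\<in>Z. lookup u x * c z z' +
          (if x = y then lookup u y * (c z z - c z z') else 0))"
        using y by (intro sum.cong) (auto simp: diag off algebra_simps)
      also have "\<dots> = aug u * c z z' + lookup u y * (c z z - c z z')"
        using u y Z(2) aug_superset[OF Z(2), of u]
        by (simp add: delta_def sum.distrib flip: sum_distrib_right)
      finally show ?thesis using u y by (simp add: delta_def)
    qed
  qed
  then show ?thesis by blast
qed

subsection \<open>A pair of quandles with isomorphic rings\<close>

locale quandle_ring_pair = X: quandle QX opX + Y: quandle QY opY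
  for QX :: "'a set" and opX and QY :: "'b set" and opY +
  fixes \<phi> :: "('a \<Rightarrow>\<^sub>0 'k::field) \<Rightarrow> ('b \<Rightarrow>\<^sub>0 'k)"
  assumes finX: "finite QX" and finY: "finite QY"
    and transX: "orbit_two_transitive QX opX" and transY: "orbit_two_transitive QY opY"
    and iso: "\<phi> \<in> quandle_ring_iso QX opX QY opY"
begin

definition "\<phi>' = inv_into (quandle_ring QX) \<phi>"

abbreviation "OX \<equiv> quandle_orbits QX opX"
abbreviation "OY \<equiv> quandle_orbits QY opY"
abbreviation "T \<equiv> quandle_ring QX :: ('a \<Rightarrow>\<^sub>0 'k) set"
abbreviation "E \<equiv> right_hom QX opX QX opX (\<lambda>v. v) :: (('a \<Rightarrow>\<^sub>0 'k) \<Rightarrow> _) \<Rightarrow> bool"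

text \<open>Projections and scalars of \<open>k[Y]\<close>, transported to \<open>k[X]\<close>. As the isomorphism need not be
  linear, \<open>s b\<close> need not be multiplication by a scalar of \<open>k[X]\<close>.\<close>

definition "q W u = \<phi>' (restr W (\<phi> u))"
definition "s b u = \<phi>' (scal b (\<phi> u))"
definition "delta' W = {u \<in> T. \<phi> u \<in> delta W}"

lemma iso': "\<phi>' \<in> quandle_ring_iso QY opY QX opX"
  unfolding \<phi>'_def by (rule X.inv_iso[OF iso])

lemmas hom\<phi> = iso_right_hom[OF iso] and hom\<phi>' = iso_right_hom[OF iso']
lemmas \<phi>_mem = right_hom_mem[OF hom\<phi>] and \<phi>'_mem = right_hom_mem[OF hom\<phi>']

lemma \<phi>'_\<phi> [simp]: "u \<in> T \<Longrightarrow> \<phi>' (\<phi> u) = u"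
  using iso by (simp add: \<phi>'_def quandle_ring_iso_def bij_betw_def)

lemma \<phi>_\<phi>' [simp]: "u \<in> quandle_ring QY \<Longrightarrow> \<phi> (\<phi>' u) = u"
  using iso by (auto simp: \<phi>'_def quandle_ring_iso_def bij_betw_def f_inv_into_f)

lemma E_id: "E (\<lambda>u. u)"
  by (auto simp: right_hom_def X.rmult_mem)

lemma E_comp: "E F \<Longrightarrow> E G \<Longrightarrow> E (\<lambda>u. F (G u))"
  using right_hom_comp[of QX opX QX opX "\<lambda>v. v" G QX opX "\<lambda>v. v" F "\<lambda>v. v"] by simp

text \<open>The twists along \<open>\<phi>\<close> and \<open>\<phi>'\<close> cancel, so
  endomorphisms of \<open>k[Y]\<close> become endomorphisms of \<open>k[X]\<close> and the matching
  argument can be carried out in one ring.\<close>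

lemma E_conj:
  assumes "right_hom QY opY QY opY (\<lambda>v. v) F" shows "E (\<lambda>u. \<phi>' (F (\<phi> u)))"
proof -
  have "right_hom QX opX QY opY \<phi> (\<lambda>u. F (\<phi> u))"
    by (rule right_hom_comp[OF hom\<phi> assms]) (simp_all add: \<phi>_mem)
  then show ?thesis
    by (rule right_hom_comp[OF _ hom\<phi>']) (simp_all add: \<phi>_mem)
qed

lemma E_conj':
  assumes "E F" shows "right_hom QY opY QY opY (\<lambda>v. v) (\<lambda>u. \<phi> (F (\<phi>' u)))"
proof -
  have "right_hom QY opY QX opX \<phi>' (\<lambda>u. F (\<phi>' u))"
    by (rule right_hom_comp[OF hom\<phi>' assms]) (simp_all add: \<phi>'_mem)
  then show ?thesis
    by (rule right_hom_comp[OF _ hom\<phi>]) (simp_all add: \<phi>'_mem)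
qed

lemma E_q: "W \<in> OY \<Longrightarrow> E (q W)"
  using E_conj[OF Y.right_hom_restr[OF finY]] by (simp add: q_def[abs_def])

lemma E_s: "E (s b)"
  using E_conj[OF right_hom_scal] by (simp add: s_def[abs_def])

lemma E_restr: "Z \<in> OX \<Longrightarrow> E (restr Z)"
  by (rule X.right_hom_restr[OF finX])

lemmas E_intros = E_id E_comp[OF E_q] E_comp[OF E_s] E_comp[OF E_restr] E_comp[OF right_hom_scal]

lemma delta_mem: "Z \<in> OX \<Longrightarrow> u \<in> delta Z \<Longrightarrow> u \<in> T"
  using X.orbit_subset[OF finX] by (auto simp: delta_def quandle_ring_def)

lemma delta_mem_Y: "W \<in> OY \<Longrightarrow> u \<in> delta W \<Longrightarrow> u \<in> quandle_ring QY"
  using Y.orbit_subset[OF finY] by (auto simp: delta_def quandle_ring_def)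

lemma delta'_mem: "u \<in> delta' W \<Longrightarrow> u \<in> T"
  by (simp add: delta'_def)

text \<open>This is \<open>right_hom_delta\<close> for \<open>F\<close> followed by
  \<open>\<phi>\<close>. With \<open>restr_delta'\<close> it moves augmentation-zero parts back and
  forth between the two decompositions of \<open>k[X]\<close>.\<close>

lemma q_delta:
  assumes "E F" "Z \<in> OX" "W \<in> OY" "u \<in> delta Z" shows "q W (F u) \<in> delta' W"
proof -
  have "right_hom QX opX QY opY \<phi> (\<lambda>u. \<phi> (F u))"
    by (rule right_hom_comp[OF assms(1) hom\<phi>]) simp_all
  then have "restr W (\<phi> (F u)) \<in> delta W"
    by (rule right_hom_delta[OF X.quandle_axioms finX assms(2) Y.quandle_axioms finY assms(3) iso
          _ assms(4)])
  moreover have "\<phi> (F u) \<in> quandle_ring QY"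
    using \<phi>_mem right_hom_mem[OF assms(1)] delta_mem assms by blast
  ultimately show ?thesis
    by (simp add: delta'_def q_def \<phi>'_mem quandle_ring_restr)
qed

lemma restr_delta':
  assumes "E F" "Z \<in> OX" "W \<in> OY" "u \<in> delta' W" shows "restr Z (F u) \<in> delta Z"
proof -
  have "right_hom QY opY QX opX \<phi>' (\<lambda>u. F (\<phi>' u))"
    by (rule right_hom_comp[OF hom\<phi>' assms(1)]) (simp_all add: \<phi>'_mem)
  moreover have "\<phi> u \<in> delta W" using assms(4) by (simp add: delta'_def)
  ultimately have "restr Z (F (\<phi>' (\<phi> u))) \<in> delta Z"
    by (rule right_hom_delta[OF Y.quandle_axioms finY assms(3) X.quandle_axioms finX assms(2) iso'])
  then show ?thesis using delta'_mem[OF assms(4)] by simp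
qed

lemma scalar_on_delta: "E F \<Longrightarrow> Z \<in> OX \<Longrightarrow> \<exists>a. \<forall>u\<in>delta Z. restr Z (F u) = scal a u"
  by (rule X.endo_scalar_on_delta[OF finX transX])

lemma scalar_on_delta':
  assumes "E F" "W \<in> OY" shows "\<exists>b. \<forall>u\<in>delta' W. q W (F u) = s b u"
proof -
  obtain b where "\<forall>u\<in>delta W. restr W (\<phi> (F (\<phi>' u))) = scal b u"
    using Y.endo_scalar_on_delta[OF finY transY assms(2) E_conj'[OF assms(1)]] by blast
  then show ?thesis by (intro exI[of _ b]) (auto simp: delta'_def q_def s_def)
qed

lemma sum_restr_orbits_Y: "u \<in> quandle_ring QY \<Longrightarrow> (\<Sum>W\<in>OY. restr W u) = u"
proof (rule poly_mapping_eqI)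
  fix y assume u: "u \<in> quandle_ring QY"
  show "lookup (\<Sum>W\<in>OY. restr W u) y = lookup u y"
  proof (cases "y \<in> QY")
    case True
    then obtain W where W: "W \<in> OY" "y \<in> W" using Y.in_some_orbit by blast
    have "(\<Sum>V\<in>OY. lookup (restr V u) y) = (\<Sum>V\<in>OY. if V = W then lookup u y else 0)"
      using W Y.orbits_disjoint[OF finY _ W(1)] by (intro sum.cong) auto
    also have "\<dots> = lookup u y" using W Y.quandle_orbits_finite[OF finY] by simp
    finally show ?thesis by (simp add: lookup_sum)
  next
    case False
    then have "lookup u y = 0" using u by (auto simp: quandle_ring_def in_keys_iff)
    then show ?thesis by (auto simp: lookup_sum intro!: sum.neutral)
  qed
qed

text \<open>The second decomposition of \<open>k[X]\<close>, transported from the orbits of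
  \<open>QY\<close>. Inserted between maps attached to orbits of \<open>QX\<close>, it links the two
  sets of orbits.\<close>

lemma sum_q: "u \<in> T \<Longrightarrow> (\<Sum>W\<in>OY. q W u) = u"
  using right_hom_sum[OF hom\<phi>', of OY "\<lambda>W. restr W (\<phi> u)"]
  by (simp add: q_def sum_restr_orbits_Y \<phi>_mem quandle_ring_restr)

text \<open>\<open>CX Z0\<close> and \<open>CY Z0\<close> collect the orbits through which the
  identity of \<open>delta Z0\<close> factors. Only a one-sided inverse is demanded; for orbits of
  \<open>QY\<close> and \<open>card Z0 \<ge> 2\<close>, \<open>retract_inverse\<close> makes it
  two-sided.\<close>

definition "CX Z0 = {Z \<in> OX. \<exists>u v. E u \<and> E v \<and> (\<forall>d\<in>delta Z0. restr Z0 (u (restr Z (v d))) = d)}"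

definition "CY Z0 = {W \<in> OY. \<exists>g f. E g \<and> E f \<and> (\<forall>d\<in>delta Z0. restr Z0 (g (q W (f d))) = d)}"

lemma delta_nonzero:
  assumes "finite Z" "card Z \<ge> 2" shows "\<exists>d\<in>delta Z. (d :: 'a \<Rightarrow>\<^sub>0 'k) \<noteq> 0"
proof -
  obtain x y where xy: "x \<in> Z" "y \<in> Z" "x \<noteq> y"
    using assms card_le_Suc0_iff_eq[OF assms(1)] by fastforce
  let ?d = "single x 1 + single y (-1) :: 'a \<Rightarrow>\<^sub>0 'k"
  have "?d \<in> delta Z"
    using xy keys_add[of "single x 1" "single y (-1::'k)"] by (auto simp: delta_def aug_add)
  moreover have "lookup ?d x = 1" using xy by (simp add: lookup_add lookup_single_not_eq)
  ultimately show ?thesis by (metis lookup_zero zero_neq_one)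
qed

section \<open>Matching classes of an orbit with at least two points\<close>

context
  fixes Z0 assumes Z0: "Z0 \<in> OX" "card Z0 \<ge> 2"
begin

text \<open>For an endomorphism \<open>F\<close> this scalar exists by
  \<open>scalar_on_delta\<close>, and it is unique because \<open>delta Z0\<close> is
  nonzero.\<close>

definition "\<alpha> F = (SOME a. \<forall>d\<in>delta Z0. restr Z0 (F d) = scal a d)"

lemma \<alpha>: "E F \<Longrightarrow> d \<in> delta Z0 \<Longrightarrow> restr Z0 (F d) = scal (\<alpha> F) d"
  unfolding \<alpha>_def using someI_ex[OF scalar_on_delta[OF _ Z0(1)]] by blast

text \<open>A nonzero test vector: identities between scalars are checked on it.\<close>

definition "d0 = (SOME d :: 'a \<Rightarrow>\<^sub>0 'k. d \<in> delta Z0 \<and> d \<noteq> 0)"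

lemma d0: "d0 \<in> delta Z0" "d0 \<noteq> 0"
  using someI_ex[of "\<lambda>d. d \<in> delta Z0 \<and> d \<noteq> 0"] delta_nonzero[of Z0] X.orbit_finite[OF finX Z0(1)] Z0(2)
  unfolding d0_def by blast+

lemma scal_d0_cancel: "scal a d0 = scal b d0 \<Longrightarrow> a = b"
proof -
  assume eq: "scal a d0 = scal b d0"
  obtain x where "lookup d0 x \<noteq> 0" using d0(2) by (metis poly_mapping_eqI lookup_zero)
  moreover have "a * lookup d0 x = b * lookup d0 x" using eq by (metis lookup_scal)
  ultimately show "a = b" by simp
qed

text \<open>The composite acts on \<open>delta' W\<close> through a scalar of \<open>k[Y]\<close> that fixes a nonzero vector.\<close>

lemma retract_inverse:
  assumes W: "W \<in> OY" and gf: "E g" "E f" "\<And>d. d \<in> delta Z0 \<Longrightarrow> restr Z0 (g (q W (f d))) = d"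
    and e: "e \<in> delta' W"
  shows "q W (f (restr Z0 (g e))) = e"
proof -
  have "E (\<lambda>u. f (restr Z0 (g u)))" by (intro E_intros E_comp[OF gf(1)] E_comp[OF gf(2)] Z0)
  then obtain b where b: "\<And>e. e \<in> delta' W \<Longrightarrow> q W (f (restr Z0 (g e))) = s b e"
    using scalar_on_delta'[OF _ W] by blast
  define e0 where "e0 = q W (f d0)"
  have e0: "e0 \<in> delta' W" unfolding e0_def by (rule q_delta[OF gf(2) Z0(1) W d0(1)])
  have ge0: "restr Z0 (g e0) = d0" unfolding e0_def by (rule gf(3)[OF d0(1)])
  then have "s b e0 = e0" using b[OF e0] by (simp add: e0_def)
  then have "\<phi> (s b e0) = \<phi> e0" by simp
  then have *: "scal b (\<phi> e0) = \<phi> e0"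
    using delta'_mem[OF e0] by (simp add: s_def \<phi>_mem quandle_ring_scal)
  have "\<phi> e0 \<noteq> 0"
  proof
    assume "\<phi> e0 = 0"
    then have "e0 = 0" using \<phi>'_\<phi>[OF delta'_mem[OF e0]] right_hom_0[OF hom\<phi>'] by simp
    then show False using ge0 d0(2) right_hom_0[OF gf(1)] by (simp add: restr_disjoint)
  qed
  then obtain y where "lookup (\<phi> e0) y \<noteq> 0" by (metis poly_mapping_eqI lookup_zero)
  moreover have "b * lookup (\<phi> e0) y = lookup (\<phi> e0) y" using * by (metis lookup_scal)
  ultimately have "b = 1" by simp
  then show ?thesis using b[OF e] delta'_mem[OF e] by (simp add: s_def)
qed

text \<open>Were the scalar nonzero, dividing \<open>g\<close> by it would factor the identity of
  \<open>delta Z0\<close> through \<open>W\<close>.\<close>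

lemma \<alpha>_eq_0:
  assumes "W \<in> OY" "W \<notin> CY Z0" "E g" "E f"
  shows "\<alpha> (\<lambda>u. g (q W (f u))) = 0"
proof (rule ccontr)
  let ?a = "\<alpha> (\<lambda>u. g (q W (f u)))"
  assume a: "?a \<noteq> 0"
  have E: "E (\<lambda>u. g (q W (f u)))" by (intro E_intros E_comp[OF assms(3)] E_comp[OF assms(4)] assms(1))
  have "restr Z0 (scal (inverse ?a) (g (q W (f d)))) = d" if "d \<in> delta Z0" for d
    using \<alpha>[OF E that] a by (simp add: restr_scal scal_scal)
  moreover have "E (\<lambda>u. scal (inverse ?a) (g u))" by (intro E_intros E_comp[OF assms(3)])
  ultimately have "W \<in> CY Z0" using assms(1,4) unfolding CY_def by blast
  then show False using assms(2) by simp
qed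

text \<open>The composites of the maps \<open>u Z\<close> and \<open>v Z'\<close> act by the scalars
  of an identity matrix. Splitting them over the orbits of \<open>QY\<close> writes this matrix as a
  product with inner index set \<open>CY Z0\<close>.\<close>

lemma card_CX_le_card_CY: "card (CX Z0) \<le> card (CY Z0)"
proof -
  have "\<forall>Z\<in>CX Z0. \<exists>u v. E u \<and> E v \<and> (\<forall>d\<in>delta Z0. restr Z0 (u (restr Z (v d))) = d)"
    by (simp add: CX_def)
  then obtain u v where uv: "\<And>Z. Z \<in> CX Z0 \<Longrightarrow> E (u Z)" "\<And>Z. Z \<in> CX Z0 \<Longrightarrow> E (v Z)"
    "\<And>Z d. Z \<in> CX Z0 \<Longrightarrow> d \<in> delta Z0 \<Longrightarrow> restr Z0 (u Z (restr Z (v Z d))) = d"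
    by metis
  have "\<forall>W\<in>CY Z0. \<exists>g f. E g \<and> E f \<and> (\<forall>d\<in>delta Z0. restr Z0 (g (q W (f d))) = d)"
    by (simp add: CY_def)
  then obtain g f where gf: "\<And>W. W \<in> CY Z0 \<Longrightarrow> E (g W)" "\<And>W. W \<in> CY Z0 \<Longrightarrow> E (f W)"
    "\<And>W d. W \<in> CY Z0 \<Longrightarrow> d \<in> delta Z0 \<Longrightarrow> restr Z0 (g W (q W (f W d))) = d"
    by metis
  have sub: "CX Z0 \<subseteq> OX" "CY Z0 \<subseteq> OY" by (auto simp: CX_def CY_def)
  define B where "B = (\<lambda>Z W. \<alpha> (\<lambda>d. u Z (restr Z (q W (f W d)))))"
  define A where "A = (\<lambda>W Z. \<alpha> (\<lambda>d. g W (q W (restr Z (v Z d)))))"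
  \<comment> \<open>In \<open>B Z W * A W Z'\<close> the inner factor \<open>f W \<circ> restr Z0 \<circ> g W\<close> cancels, leaving the \<open>W\<close>-summand
    of the identity between \<open>u Z\<close> and \<open>v Z'\<close>; the orbits outside \<open>CY Z0\<close> contribute nothing.\<close>
  show ?thesis
  proof (rule card_le_if_matrix_inverse[of _ _ B A])
    show "finite (CX Z0)" "finite (CY Z0)"
      using sub X.quandle_orbits_finite[OF finX] Y.quandle_orbits_finite[OF finY]
      by (auto intro: finite_subset)
    fix Z Z' assume Z: "Z \<in> CX Z0" and Z': "Z' \<in> CX Z0"
    have ZO: "Z \<in> OX" "Z' \<in> OX" using Z Z' sub by auto
    \<comment> \<open>The scalar of the \<open>W\<close>-summand, with \<open>q W\<close> inserted
      between the projections to \<open>Z\<close> and \<open>Z'\<close>.\<close>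
    define \<gamma> where "\<gamma> = (\<lambda>W. \<alpha> (\<lambda>d. u Z (restr Z (q W (restr Z' (v Z' d))))))"
    have \<gamma>: "scal (\<gamma> W) d0 = restr Z0 (u Z (restr Z (q W (restr Z' (v Z' d0)))))" if "W \<in> OY" for W
      unfolding \<gamma>_def by (intro \<alpha>[symmetric] d0 E_intros E_comp[OF uv(1)[OF Z]] E_comp[OF uv(2)[OF Z']] ZO that)
    have prod: "B Z W * A W Z' = \<gamma> W" if W: "W \<in> CY Z0" for W
    proof (rule scal_d0_cancel)
      have WO: "W \<in> OY" using W sub by auto
      have EB: "E (\<lambda>d. u Z (restr Z (q W (f W d))))"
        and EA: "E (\<lambda>d. g W (q W (restr Z' (v Z' d))))"
        and Ev: "E (\<lambda>d. restr Z' (v Z' d))"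
        by (intro E_intros E_comp[OF uv(1)[OF Z]] E_comp[OF uv(2)[OF Z']]
            E_comp[OF gf(1)[OF W]] E_comp[OF gf(2)[OF W]] ZO WO)+
      let ?e = "q W (restr Z' (v Z' d0))"
      have e: "?e \<in> delta' W" by (rule q_delta[OF Ev Z0(1) WO d0(1)])
      have "scal (B Z W * A W Z') d0 = scal (B Z W) (restr Z0 (g W ?e))"
        unfolding A_def by (simp add: \<alpha>[OF EA d0(1)] scal_scal)
      also have "\<dots> = restr Z0 (u Z (restr Z (q W (f W (restr Z0 (g W ?e))))))"
        unfolding B_def
        by (intro \<alpha>[OF EB, symmetric] restr_delta'[OF gf(1)[OF W] Z0(1) WO e])
      also have "\<dots> = scal (\<gamma> W) d0"
        using retract_inverse[OF WO gf(1,2)[OF W] gf(3)[OF W] e] by (simp add: \<gamma>[OF WO])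
      finally show "scal (B Z W * A W Z') d0 = scal (\<gamma> W) d0" .
    qed
    have zero: "\<gamma> W = 0" if "W \<in> OY - CY Z0" for W
      unfolding \<gamma>_def using that
      by (intro \<alpha>_eq_0[of W "\<lambda>x. u Z (restr Z x)" "\<lambda>d. restr Z' (v Z' d)"] E_intros
          E_comp[OF uv(1)[OF Z]] E_comp[OF uv(2)[OF Z']] ZO) auto
    have "(\<Sum>W\<in>CY Z0. B Z W * A W Z') = (\<Sum>W\<in>OY. \<gamma> W)"
      using prod zero sub Y.quandle_orbits_finite[OF finY]
      by (intro sum.mono_neutral_cong_left) auto
    also have "\<dots> = (if Z = Z' then 1 else 0)"
    \<comment> \<open>Summed over all of \<open>OY\<close>, the maps \<open>q W\<close> give the
      identity. What remains contains \<open>restr Z\<close> after \<open>restr Z'\<close>, which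
      vanishes for distinct orbits.\<close>
    proof (rule scal_d0_cancel)
      have Eu: "E (\<lambda>x. restr Z0 (u Z (restr Z x)))" by (intro E_intros E_comp[OF uv(1)[OF Z]] ZO Z0)
      have vT: "restr Z' (v Z' d0) \<in> T"
        by (intro quandle_ring_restr right_hom_mem[OF uv(2)[OF Z']] delta_mem[OF Z0(1) d0(1)])
      have "scal (\<Sum>W\<in>OY. \<gamma> W) d0 = (\<Sum>W\<in>OY. restr Z0 (u Z (restr Z (q W (restr Z' (v Z' d0))))))"
        by (simp add: \<gamma> flip: sum_scal)
      also have "\<dots> = restr Z0 (u Z (restr Z (\<Sum>W\<in>OY. q W (restr Z' (v Z' d0)))))"
        by (rule right_hom_sum[OF Eu, symmetric]) (rule right_hom_mem[OF E_q vT])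
      also have "\<dots> = restr Z0 (u Z (restr Z (restr Z' (v Z' d0))))"
        by (simp only: sum_q[OF vT])
      also have "\<dots> = scal (if Z = Z' then 1 else 0) d0"
      proof (cases "Z = Z'")
        case True
        then show ?thesis using uv(3)[OF Z' d0(1)] by (simp add: restr_restr)
      next
        case False
        then have "restr Z (restr Z' (v Z' d0)) = 0"
          using X.orbits_disjoint[OF finX ZO] by (simp add: restr_restr restr_disjoint)
        then show ?thesis using False right_hom_0[OF uv(1)[OF Z]] by (simp add: restr_disjoint)
      qed
      finally show "scal (\<Sum>W\<in>OY. \<gamma> W) d0 = scal (if Z = Z' then 1 else 0) d0" .
    qed
    finally show "(\<Sum>W\<in>CY Z0. B Z W * A W Z') = (if Z = Z' then 1 else 0)" .
  qed
qed

text \<open>On \<open>delta' W\<close> the map \<open>g\<close> is \<open>\<theta>\<close>-semilinear and onto \<open>delta Z0\<close>, so the \<open>g\<close>-images of a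
  spanning set of \<open>delta W\<close> span \<open>delta Z0\<close>; no surjectivity of \<open>\<theta>\<close> is involved.\<close>

lemma CY_card:
  assumes "W \<in> CY Z0" shows "card Z0 \<le> card W"
proof -
  obtain g f where W: "W \<in> OY" and gf: "E g" "E f"
    "\<And>d. d \<in> delta Z0 \<Longrightarrow> restr Z0 (g (q W (f d))) = d"
    using assms unfolding CY_def by blast
  have finZ: "finite Z0" and finW: "finite W"
    using X.orbit_finite[OF finX Z0(1)] Y.orbit_finite[OF finY W] by auto
  obtain z0 where z0: "z0 \<in> Z0" using X.orbit_nonempty[OF Z0(1)] by blast
  obtain w0 where w0: "w0 \<in> W" using Y.orbit_nonempty[OF W] by blast
  \<comment> \<open>\<open>\<theta> b\<close> is the scalar of \<open>k[X]\<close> through which the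
    transported scalar \<open>b\<close> of \<open>k[Y]\<close> acts on
    \<open>delta Z0\<close>.\<close>
  define \<theta> where "\<theta> = (\<lambda>b. \<alpha> (\<lambda>d. g (s b (q W (f d)))))"
  have \<theta>: "restr Z0 (g (s b e)) = scal (\<theta> b) (restr Z0 (g e))" if e: "e \<in> delta' W" for b e
  proof -
    have "E (\<lambda>d. g (s b (q W (f d))))" by (intro E_intros E_comp[OF gf(1)] E_comp[OF gf(2)] W)
    then have "restr Z0 (g (s b (q W (f (restr Z0 (g e)))))) = scal (\<theta> b) (restr Z0 (g e))"
      unfolding \<theta>_def by (rule \<alpha>[OF _ restr_delta'[OF gf(1) Z0(1) W e]])
    then show ?thesis by (simp add: retract_inverse[OF W gf e])
  qed
  \<comment> \<open>The differences \<open>z - z0\<close> and \<open>w - w0\<close> form bases of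
    \<open>delta Z0\<close> and \<open>delta W\<close>, so one base point is removed on each
    side.\<close>
  let ?I = "Z0 - {z0}" and ?J = "W - {w0}"
  define d where "d = (\<lambda>z. single z 1 + single z0 (-1) :: 'a \<Rightarrow>\<^sub>0 'k)"
  define t where "t = (\<lambda>w. single w 1 + single w0 (-1) :: 'b \<Rightarrow>\<^sub>0 'k)"
  have t: "t w \<in> delta W" if "w \<in> W" for w
    using that w0 keys_add[of "single w 1" "single w0 (-1::'k)"]
    by (auto simp: delta_def aug_add t_def)
  have t': "\<phi>' (t w) \<in> delta' W" if "w \<in> W" for w
    using t[OF that] delta_mem_Y[OF W t[OF that]] by (simp add: delta'_def \<phi>'_mem)
  have d: "d z \<in> delta Z0" if "z \<in> Z0" for z
    using that z0 keys_add[of "single z 1" "single z0 (-1::'k)"]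
    by (auto simp: delta_def aug_add d_def)
  have span: "x = (\<Sum>w\<in>?J. scal (lookup x w) (t w))" if x: "x \<in> delta W" for x
  proof (rule poly_mapping_eqI)
    fix y
    have tl: "c * lookup (t w) y = (if w = y then c else 0) + (if y = w0 then - c else 0)" for c w
      by (simp add: t_def lookup_add lookup_single when_def)
    have "lookup x w0 = - (\<Sum>w\<in>?J. lookup x w)"
      using x aug_superset[OF finW, of x] w0 finW
      by (simp add: delta_def sum.remove[of W w0] eq_neg_iff_add_eq_0)
    moreover have "lookup (\<Sum>w\<in>?J. scal (lookup x w) (t w)) y =
        (\<Sum>w\<in>?J. if w = y then lookup x w else 0) + (if y = w0 then - (\<Sum>w\<in>?J. lookup x w) else 0)"
      unfolding lookup_sum lookup_scal tl by (simp add: sum.distrib sum_negf del: sum.delta)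
    moreover have "lookup x y = 0" if "y \<notin> W"
      using x that by (auto simp: delta_def in_keys_iff)
    ultimately show "lookup x y = lookup (\<Sum>w\<in>?J. scal (lookup x w) (t w)) y"
      using finW by auto
  qed
  define e where "e = (\<lambda>z. \<phi> (q W (f (d z))))"
  have "card ?I \<le> card ?J"
  \<comment> \<open>The first matrix holds the coordinates of the image of \<open>d z\<close> in
    terms of the \<open>t w\<close>, pushed through \<open>\<theta>\<close>; the second holds the
    coefficients of the \<open>g\<close>-images of the \<open>t w\<close>. Their product returns the
    coefficients of \<open>d z\<close>, which away from \<open>z0\<close> are Kronecker
    deltas.\<close>
  proof (rule card_le_if_matrix_inverse[of _ _ "\<lambda>z w. \<theta> (lookup (e z) w)"
        "\<lambda>w z. lookup (restr Z0 (g (\<phi>' (t w)))) z"])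
    fix z z' assume z: "z \<in> ?I" and z': "z' \<in> ?I"
    have qf: "q W (f (d z)) \<in> delta' W" using q_delta[OF gf(2) Z0(1) W] d z by blast
    then have ed: "e z \<in> delta W" by (simp add: delta'_def e_def)
    have "q W (f (d z)) = \<phi>' (\<Sum>w\<in>?J. scal (lookup (e z) w) (t w))"
      using span[OF ed] delta'_mem[OF qf] by (simp add: e_def)
    also have "\<dots> = (\<Sum>w\<in>?J. \<phi>' (scal (lookup (e z) w) (t w)))"
      using delta_mem_Y[OF W t] by (intro right_hom_sum[OF hom\<phi>'] quandle_ring_scal) auto
    also have "\<dots> = (\<Sum>w\<in>?J. s (lookup (e z) w) (\<phi>' (t w)))"
      using delta_mem_Y[OF W t] by (intro sum.cong) (auto simp: s_def)
    finally have "d z = restr Z0 (g (\<Sum>w\<in>?J. s (lookup (e z) w) (\<phi>' (t w))))"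
      using gf(3)[OF d, of z] z by simp
    also have "\<dots> = (\<Sum>w\<in>?J. restr Z0 (g (s (lookup (e z) w) (\<phi>' (t w)))))"
    proof (rule right_hom_sum)
      show "E (\<lambda>x. restr Z0 (g x))" by (intro E_intros E_comp[OF gf(1)] Z0)
      show "s (lookup (e z) w) (\<phi>' (t w)) \<in> T" if "w \<in> ?J" for w
        using that by (intro right_hom_mem[OF E_s] delta'_mem[OF t']) auto
    qed
    also have "\<dots> = (\<Sum>w\<in>?J. scal (\<theta> (lookup (e z) w)) (restr Z0 (g (\<phi>' (t w)))))"
      using t' by (intro sum.cong) (auto simp: \<theta>)
    finally have "lookup (d z) z' =
        (\<Sum>w\<in>?J. \<theta> (lookup (e z) w) * lookup (restr Z0 (g (\<phi>' (t w)))) z')"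
      by (simp only: lookup_sum lookup_scal)
    moreover have "lookup (d z) z' = (if z = z' then 1 else 0)"
      using z' by (auto simp: d_def lookup_add lookup_single when_def)
    ultimately show "(\<Sum>w\<in>?J. \<theta> (lookup (e z) w) * lookup (restr Z0 (g (\<phi>' (t w)))) z') =
        (if z = z' then 1 else 0)" by simp
  qed (use finZ finW in auto)
  then show ?thesis using z0 w0 finZ finW Z0(2) by simp
qed

text \<open>The identity of \<open>delta Z0\<close> is routed from \<open>Z0\<close> to
  \<open>W\<close>, on to \<open>Z1\<close>, back to \<open>W\<close> and back to \<open>Z0\<close>.
  Thus classes that share an orbit of \<open>QY\<close> belong together.\<close>

lemma CX_if_CY_overlap:
  assumes Z1: "Z1 \<in> OX" and W: "W \<in> CY Z0"
    and gf1: "E g1" "E f1" "\<And>e. e \<in> delta' W \<Longrightarrow> q W (f1 (restr Z1 (g1 e))) = e"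
  shows "Z1 \<in> CX Z0"
proof -
  obtain g f where WO: "W \<in> OY" and gf: "E g" "E f"
    "\<And>d. d \<in> delta Z0 \<Longrightarrow> restr Z0 (g (q W (f d))) = d"
    using W unfolding CY_def by blast
  have "E (\<lambda>x. g (q W (f1 x)))" "E (\<lambda>x. g1 (q W (f x)))" 
    by (intro E_intros E_comp[OF gf(1)] E_comp[OF gf(2)] E_comp[OF gf1(1)] E_comp[OF gf1(2)] WO)+
  moreover have "restr Z0 (g (q W (f1 (restr Z1 (g1 (q W (f d))))))) = d" if "d \<in> delta Z0" for d
    using gf1(3)[OF q_delta[OF gf(2) Z0(1) WO that]] gf(3)[OF that] by simp
  ultimately show ?thesis using Z1 unfolding CX_def by blast
qed

end

section \<open>Counting orbits above a given size\<close>

lemma card_large_orbits_le: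
  assumes "n \<ge> 2"
  shows "card {Z \<in> OX. n \<le> card Z} \<le> card {W \<in> OY. n \<le> card W}"
proof (rule card_le_if_overlapping_classes[of _ _ CX CY])
  note finO = X.quandle_orbits_finite[OF finX] Y.quandle_orbits_finite[OF finY]
  show "finite {Z \<in> OX. n \<le> card Z}" "finite {W \<in> OY. n \<le> card W}" using finO by auto
  fix Z assume Z: "Z \<in> {Z \<in> OX. n \<le> card Z}"
  then have ZO: "Z \<in> OX" "card Z \<ge> 2" using assms by auto
  have "restr Z (restr Z d) = d" if "d \<in> delta Z" for d :: "'a \<Rightarrow>\<^sub>0 'k"
    using that by (simp add: delta_def restr_id)
  then show "Z \<in> CX Z" using ZO E_id by (auto simp: CX_def)
  \<comment> \<open>The dimension bound ensures that matched orbits stay above the threshold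
    \<open>n\<close>.\<close>
  show "CY Z \<subseteq> {W \<in> OY. n \<le> card W}"
    using CY_card[OF ZO] Z by (fastforce simp: CY_def)
  have "card ({Z \<in> OX. n \<le> card Z} \<inter> CX Z) \<le> card (CX Z)"
    using finO(1) by (intro card_mono) (auto simp: CX_def)
  also have "\<dots> \<le> card (CY Z)" by (rule card_CX_le_card_CY[OF ZO])
  finally show "card ({Z \<in> OX. n \<le> card Z} \<inter> CX Z) \<le> card (CY Z)" .
  fix Z' assume Z': "Z' \<in> {Z \<in> OX. n \<le> card Z}" and "CY Z \<inter> CY Z' \<noteq> {}"
  then obtain W where W: "W \<in> CY Z" "W \<in> CY Z'" by blast
  have ZO': "Z' \<in> OX" "card Z' \<ge> 2" using assms Z' by auto
  obtain g f where WO: "W \<in> OY" and gf: "E g" "E f"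
    "\<And>d. d \<in> delta Z' \<Longrightarrow> restr Z' (g (q W (f d))) = d"
    using W(2) unfolding CY_def by blast
  show "Z' \<in> CX Z"
    by (rule CX_if_CY_overlap[OF ZO ZO'(1) W(1) gf(1,2) retract_inverse[OF ZO' WO gf]])
qed

text \<open>Recording the augmentation on each orbit turns \<open>\<phi>\<close> and
  \<open>\<phi>'\<close> into matrices indexed by orbits. Up to the map \<open>\<tau>\<close>, their
  product is the identity, because \<open>\<phi>'\<close> undoes \<open>\<phi>\<close>.\<close>

lemma card_orbits_le: "card OX \<le> card OY"
proof -
  obtain \<tau> where \<tau>: "\<tau> 0 = 0" "\<tau> 1 = 1" "\<And>a b. \<tau> (a + b) = \<tau> a + \<tau> b"
    "\<And>u. u \<in> quandle_ring QY \<Longrightarrow> aug (\<phi>' u) = \<tau> (aug u)"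
    using Y.iso_aug[OF iso' finY] by metis
  have "\<forall>Z\<in>OX. \<exists>c. \<forall>W\<in>OY. \<forall>u. keys u \<subseteq> W \<longrightarrow> aug (restr Z (\<phi>' u)) = c W * \<tau> (aug u)"
    using right_hom_aug[OF Y.quandle_axioms finY X.quandle_axioms finX _ iso' hom\<phi>' \<tau>] by blast
  then obtain c where c: "\<And>Z W u. Z \<in> OX \<Longrightarrow> W \<in> OY \<Longrightarrow> keys u \<subseteq> W \<Longrightarrow>
      aug (restr Z (\<phi>' u)) = c Z W * \<tau> (aug u)"
    by metis
  \<comment> \<open>One point is chosen from each orbit; the augmentations of its basis element on
    the orbits form a unit vector.\<close>
  define b where "b = (\<lambda>Z :: 'a set. single (SOME z. z \<in> Z) 1 :: 'a \<Rightarrow>\<^sub>0 'k)"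
  have b: "b Z \<in> T" "aug (restr Z' (b Z)) = (if Z' = Z then 1 else 0)" if "Z \<in> OX" "Z' \<in> OX" for Z Z'
  proof -
    have z: "(SOME z. z \<in> Z) \<in> Z" using X.orbit_nonempty[OF that(1)] by (simp add: some_in_eq)
    then show "b Z \<in> T"
      using X.orbit_subset[OF finX that(1)] by (auto simp: b_def quandle_ring_def)
    show "aug (restr Z' (b Z)) = (if Z' = Z then 1 else 0)"
    proof (cases "Z' = Z")
      case True
      then show ?thesis using z by (simp add: b_def restr_id)
    next
      case False
      then show ?thesis
        using z X.orbits_disjoint[OF finX that] by (auto simp: b_def restr_disjoint disjoint_iff)
    qed
  qed
  show ?thesis
  proof (rule card_le_if_matrix_inverse[of _ _ c "\<lambda>W Z. \<tau> (aug (restr W (\<phi> (b Z))))"])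
    fix Z Z' assume Z: "Z \<in> OX" and Z': "Z' \<in> OX"
    note bT = b(1)[OF Z' Z]
    have "restr Z (b Z') = restr Z (\<Sum>W\<in>OY. q W (b Z'))" by (simp only: sum_q[OF bT])
    also have "\<dots> = (\<Sum>W\<in>OY. restr Z (q W (b Z')))"
      by (rule right_hom_sum[OF E_restr[OF Z]]) (rule right_hom_mem[OF E_q bT])
    finally have "aug (restr Z (b Z')) = (\<Sum>W\<in>OY. aug (restr Z (q W (b Z'))))"
      by (simp add: aug_sum)
    also have "\<dots> = (\<Sum>W\<in>OY. c Z W * \<tau> (aug (restr W (\<phi> (b Z')))))"
      using Z by (intro sum.cong) (auto simp: q_def c keys_restr)
    finally show "(\<Sum>W\<in>OY. c Z W * \<tau> (aug (restr W (\<phi> (b Z'))))) = (if Z = Z' then 1 else 0)"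
      using b(2)[OF Z' Z] by simp
  qed (use X.quandle_orbits_finite[OF finX] Y.quandle_orbits_finite[OF finY] in auto)
qed

text \<open>Orbits are nonempty, so \<open>n = 1\<close> counts all of them. The augmentation count
  settles this case, in which one-point orbits have a zero \<open>delta\<close> and escape the
  matching.\<close>

lemma card_orbits_ge_le:
  assumes "n \<ge> 1" shows "card {Z \<in> OX. n \<le> card Z} \<le> card {W \<in> OY. n \<le> card W}"
proof (cases "n \<ge> 2")
  case False
  have "{Z \<in> OX. 1 \<le> card Z} = OX" "{W \<in> OY. 1 \<le> card W} = OY"
    using X.orbit_nonempty X.orbit_finite[OF finX] Y.orbit_nonempty Y.orbit_finite[OF finY]
    by (auto simp: Suc_le_eq card_gt_0_iff)
  moreover have "n = 1" using False assms by simp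
  ultimately show ?thesis using card_orbits_le by simp
qed (rule card_large_orbits_le)

text \<open>The setting is symmetric, which yields the reverse inequalities.\<close>

lemma pair_swap: "quandle_ring_pair QY opY QX opX \<phi>'"
  by unfold_locales (use finX finY transX transY iso' in auto)

end

section \<open>From orbit counts to the partition type\<close>

lemma (in quandle) card_eq_sum_orbits:
  assumes "finite X"
  shows "card X = (\<Sum>Z\<in>quandle_orbits X (\<triangleright>). card Z)"
proof -
  have "card (\<Union> (quandle_orbits X (\<triangleright>))) = sum card (quandle_orbits X (\<triangleright>))"
    using orbits_disjoint[OF assms] orbit_finite[OF assms]
    by (intro card_Union_disjoint) (auto simp: pairwise_def disjnt_def)
  then show ?thesis by (simp add: Union_quandle_orbits[OF assms])
qed

theorem theorem5p3:
  fixes QX :: "'a set" and opX :: "'a \<Rightarrow> 'a \<Rightarrow> 'a"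
    and QY :: "'b set" and opY :: "'b \<Rightarrow> 'b \<Rightarrow> 'b"
  assumes "CHAR('k::field) \<noteq> 2" and "CHAR('k) \<noteq> 3"
    and "quandle QX opX" and "finite QX" and "orbit_two_transitive QX opX"
    and "quandle QY opY" and "finite QY" and "orbit_two_transitive QY opY"
    and "CHAR('k) > 3 \<longrightarrow>
           (\<forall>Z\<in>quandle_orbits QX opX. \<not> exceptional CHAR('k) (orbit_group QX opX Z) Z) \<and>
           (\<forall>Z\<in>quandle_orbits QY opY. \<not> exceptional CHAR('k) (orbit_group QY opY Z) Z)"
    and "(quandle_ring_iso QX opX QY opY :: (('a \<Rightarrow>\<^sub>0 'k) \<Rightarrow> ('b \<Rightarrow>\<^sub>0 'k)) set) \<noteq> {}"
  shows "partition_type QX opX = partition_type QY opY"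
proof -
  obtain \<phi> :: "('a \<Rightarrow>\<^sub>0 'k) \<Rightarrow> ('b \<Rightarrow>\<^sub>0 'k)" where "\<phi> \<in> quandle_ring_iso QX opX QY opY"
    using assms(10) by blast
  then interpret XY: quandle_ring_pair QX opX QY opY \<phi>
    using assms(3-8) by (simp add: quandle_ring_pair_def quandle_ring_pair_axioms_def)
  interpret YX: quandle_ring_pair QY opY QX opX XY.\<phi>'
    by (rule XY.pair_swap)
  let ?OX = "quandle_orbits QX opX" and ?OY = "quandle_orbits QY opY"
  note finO = XY.X.quandle_orbits_finite[OF assms(4)] XY.Y.quandle_orbits_finite[OF assms(7)]
  have ge: "card {Z \<in> ?OX. n \<le> card Z} = card {W \<in> ?OY. n \<le> card W}" if "n \<ge> 1" for n
    using XY.card_orbits_ge_le[OF that] YX.card_orbits_ge_le[OF that] by simp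
  \<comment> \<open>The number of orbits of size exactly \<open>n\<close> is the difference of the
    counts for the thresholds \<open>n\<close> and \<open>Suc n\<close>.\<close>
  have split: "card {Z \<in> S. n \<le> card Z} = card {Z \<in> S. card Z = n} + card {Z \<in> S. Suc n \<le> card Z}"
    if "finite S" for S :: "'c set set" and n
  proof -
    have "{Z \<in> S. n \<le> card Z} = {Z \<in> S. card Z = n} \<union> {Z \<in> S. Suc n \<le> card Z}" by auto
    then show ?thesis using that by (simp add: card_Un_disjoint disjoint_iff)
  qed
  have eq: "card {Z \<in> ?OX. card Z = n} = card {W \<in> ?OY. card W = n}" if "n \<ge> 1" for n
    using ge[OF that] ge[of "Suc n"] split[OF finO(1), of n] split[OF finO(2), of n] by simp
  \<comment> \<open>The list \<open>partition_type\<close> is as long as the quandle is large, so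
    equal cardinality is part of the claim. It is recovered from the orbit counts.\<close>
  have total: "(\<Sum>Z\<in>S. card Z) = (\<Sum>n\<in>{1..N}. n * card {Z \<in> S. card Z = n})"
    if "finite S" "\<And>Z. Z \<in> S \<Longrightarrow> card Z \<in> {1..N}" for S :: "'c set set" and N
  proof -
    have "(\<Sum>Z\<in>S. card Z) = (\<Sum>n\<in>{1..N}. \<Sum>Z\<in>{Z \<in> S. card Z = n}. card Z)"
      using that by (intro sum.group[symmetric]) auto
    also have "\<dots> = (\<Sum>n\<in>{1..N}. n * card {Z \<in> S. card Z = n})"
      by (intro sum.cong) auto
    finally show ?thesis .
  qed
  \<comment> \<open>A common bound on the orbit sizes lets both cardinalities be sums over the same
    range.\<close>
  let ?N = "max (card QX) (card QY)"
  have NX: "card Z \<in> {1..?N}" if "Z \<in> ?OX" for Z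
    using XY.X.orbit_nonempty[OF that] XY.X.orbit_finite[OF assms(4) that]
      card_mono[OF assms(4) XY.X.orbit_subset[OF assms(4) that]]
    by (auto simp: Suc_le_eq card_gt_0_iff)
  have NY: "card W \<in> {1..?N}" if "W \<in> ?OY" for W
    using XY.Y.orbit_nonempty[OF that] XY.Y.orbit_finite[OF assms(7) that]
      card_mono[OF assms(7) XY.Y.orbit_subset[OF assms(7) that]]
    by (auto simp: Suc_le_eq card_gt_0_iff)
  have "card QX = (\<Sum>n\<in>{1..?N}. n * card {Z \<in> ?OX. card Z = n})"
    by (rule trans[OF XY.X.card_eq_sum_orbits[OF assms(4)] total[OF finO(1) NX]])
  also have "\<dots> = (\<Sum>n\<in>{1..?N}. n * card {W \<in> ?OY. card W = n})"
    by (intro sum.cong) (auto simp: eq)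
  also have "\<dots> = card QY"
    by (rule trans[OF XY.Y.card_eq_sum_orbits[OF assms(7)] total[OF finO(2) NY], symmetric])
  finally show ?thesis by (auto simp: partition_type_def eq)
qed

end
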